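(* Let $U$ be a square-integrable irreducible unitary representation of a locally compact group $G$ on a Hilbert space $H$, and let $\alpha_x(a)=U_xaU_x^*$ on $K(H)$. Let $\xi\in\mathcal B_U$ be normalized so that $T_\xi^*$ is an isometry. Then for $\eta,\zeta\in\mathcal B_U$ we have $\Delta^{-1/2}T_\xi^*\eta,\Delta^{-1/2}T_\xi^*\zeta\in L^2(G)$ and $$\int_G\alpha_x(\langle\eta,\zeta\rangle_K)\,dx=\|\xi\|^{-2}\langle\Delta^{-1/2}T_\xi^*\zeta,\Delta^{-1/2}T_\xi^*\eta\rangle_{L^2(G)}\,I_H.$$
   Context: $G$ has a fixed left Haar measure $dx$ and modular function $\Delta$ with $\int f(xy)\,dx=\Delta(y^{-1})\int f(x)\,dx$. Inner products are linear in the second variable. For $\xi,\eta\in H$, $c_{\xi\eta}(x)=\langle U_x\xi,\eta\rangle$; $\xi$ is $U$-bounded if there is $k_\xi$ with $\|c_{\xi\eta}\|_{L^2(G)}\le k_\xi\|\eta\|$ for all $\eta$, and $\mathcal B_U$ is the set of $U$-bounded vectors; square-integrable means $\mathcal B_U$ is dense. For $\xi\in\mathcal B_U$, $T_\xi:L^2(G)\to H$ is the bounded extension of $g\mapsto U_g\xi=\int g(x)U_x\xi\,dx$ ($g\in L^1\cap L^2(G)$); its adjoint is $T_\xi^*\eta=c_{\xi\eta}$. For $\eta,\zeta\in H$, $\langle\eta,\zeta\rangle_K$ is the rank-one operator $\omega\mapsto\eta\langle\zeta,\omega\rangle$. The integral $\int\alpha_x(a)\,dx$ means the strong-operator (equivalently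 strict) limit of $\int\lambda(x)\alpha_x(a)\,dx$ as $\lambda$ increases through the set of $\lambda\in L^\infty(G)$ with compact support and $0\le\lambda\le1$. *)

theory Defs
  imports "HOL-Analysis.Analysis"
begin

class complex_hilbert = banach +
  fixes scaleC :: "complex \<Rightarrow> 'a \<Rightarrow> 'a" (infixr "*\<^sub>C" 75)
  fixes cinner :: "'a \<Rightarrow> 'a \<Rightarrow> complex"
  assumes scaleC_add_right: "a *\<^sub>C (x + y) = a *\<^sub>C x + a *\<^sub>C y"
  and scaleC_add_left: "(a + b) *\<^sub>C x = a *\<^sub>C x + b *\<^sub>C x"
  and scaleC_scaleC: "a *\<^sub>C (b *\<^sub>C x) = (a * b) *\<^sub>C x"
  and scaleC_one: "1 *\<^sub>C x = x"
  and scaleR_scaleC: "scaleR r x = (complex_of_real r) *\<^sub>C x"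
  and cinner_add_right: "cinner x (y + z) = cinner x y + cinner x z"
  and cinner_scaleC_right: "cinner x (a *\<^sub>C y) = a * cinner x y"
  and cinner_commute: "cinner y x = cnj (cinner x y)"
  and cinner_self_norm: "cinner x x = complex_of_real ((norm x)\<^sup>2)"

definition clinear_map :: "('a::complex_hilbert \<Rightarrow> 'a) \<Rightarrow> bool" where
  "clinear_map f \<longleftrightarrow> (\<forall>x y. f (x + y) = f x + f y) \<and> (\<forall>a x. f (a *\<^sub>C x) = a *\<^sub>C f x)"

definition unitary_op :: "('a::complex_hilbert \<Rightarrow> 'a) \<Rightarrow> bool" where
  "unitary_op V \<longleftrightarrow> clinear_map V \<and> surj V \<and> (\<forall>x y. cinner (V x) (V y) = cinner x y)"

definition closed_csubspace :: "'a::complex_hilbert set \<Rightarrow> bool" where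
  "closed_csubspace S \<longleftrightarrow> closed S \<and> 0 \<in> S \<and> (\<forall>x\<in>S. \<forall>y\<in>S. x + y \<in> S)
     \<and> (\<forall>a. \<forall>x\<in>S. a *\<^sub>C x \<in> S)"

definition rank_one :: "'a::complex_hilbert \<Rightarrow> 'a \<Rightarrow> 'a \<Rightarrow> 'a" where
  "rank_one \<eta> \<zeta> = (\<lambda>\<omega>. cinner \<zeta> \<omega> *\<^sub>C \<eta>)"

text \<open>The group operation of \<open>G\<close> is written additively (class \<open>group_add\<close>,
which does not require commutativity): \<open>x + y\<close> is the product \<open>xy\<close>,
\<open>-x\<close> the inverse, \<open>0\<close> the identity.\<close>

definition locally_compact_group :: "'g::{group_add, t2_space} itself \<Rightarrow> bool" where
  "locally_compact_group _ \<longleftrightarrow>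
     continuous_on UNIV (\<lambda>p::'g \<times> 'g. fst p + snd p) \<and>
     continuous_on UNIV (uminus :: 'g \<Rightarrow> 'g) \<and>
     (\<forall>x::'g. \<exists>K. compact K \<and> x \<in> interior K)"

definition left_haar_measure :: "'g::{group_add, t2_space} measure \<Rightarrow> bool" where
  "left_haar_measure M \<longleftrightarrow>
     sets M = sets borel \<and>
     (\<forall>g A. A \<in> sets M \<longrightarrow> emeasure M ((\<lambda>x. g + x) ` A) = emeasure M A) \<and>
     (\<forall>K. compact K \<longrightarrow> emeasure M K < \<infinity>) \<and>
     (\<forall>U. open U \<and> U \<noteq> {} \<longrightarrow> emeasure M U > 0) \<and>
     (\<forall>A. A \<in> sets M \<longrightarrow> emeasure M A = (INF U\<in>{U. open U \<and> A \<subseteq> U}. emeasure M U)) \<and>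
     (\<forall>U. open U \<longrightarrow> emeasure M U = (SUP K\<in>{K. compact K \<and> K \<subseteq> U}. emeasure M K))"

definition modular_function :: "'g::{group_add, t2_space} measure \<Rightarrow> ('g \<Rightarrow> real) \<Rightarrow> bool" where
  "modular_function M \<Delta> \<longleftrightarrow> (\<forall>y. \<Delta> y > 0) \<and>
     (\<forall>y (f::'g \<Rightarrow> real). integrable M f \<longrightarrow>
        (\<integral>x. f (x + y) \<partial>M) = \<Delta> (- y) * (\<integral>x. f x \<partial>M))"

definition square_integrable :: "'g measure \<Rightarrow> ('g \<Rightarrow> complex) \<Rightarrow> bool" where
  "square_integrable M f \<longleftrightarrow> f \<in> borel_measurable M \<and> integrable M (\<lambda>x. (cmod (f x))\<^sup>2)"

definition L2_norm_sq :: "'g measure \<Rightarrow> ('g \<Rightarrow> complex) \<Rightarrow> real" where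
  "L2_norm_sq M f = (\<integral>x. (cmod (f x))\<^sup>2 \<partial>M)"

definition L2_inner :: "'g measure \<Rightarrow> ('g \<Rightarrow> complex) \<Rightarrow> ('g \<Rightarrow> complex) \<Rightarrow> complex" where
  "L2_inner M f g = (\<integral>x. cnj (f x) * g x \<partial>M)"

definition unitary_rep :: "('g::{group_add, t2_space} \<Rightarrow> 'h::complex_hilbert \<Rightarrow> 'h) \<Rightarrow> bool" where
  "unitary_rep U \<longleftrightarrow> (\<forall>x. unitary_op (U x)) \<and> (\<forall>x y. U (x + y) = U x \<circ> U y) \<and>
     U 0 = id \<and> (\<forall>v. continuous_on UNIV (\<lambda>x. U x v))"

definition irreducible_rep :: "('g::{group_add, t2_space} \<Rightarrow> 'h::complex_hilbert \<Rightarrow> 'h) \<Rightarrow> bool" where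
  "irreducible_rep U \<longleftrightarrow> (\<exists>v::'h. v \<noteq> 0) \<and>
     (\<forall>S. closed_csubspace S \<and> (\<forall>x. U x ` S \<subseteq> S) \<longrightarrow> S = {0} \<or> S = UNIV)"

definition coeff :: "('g \<Rightarrow> 'h::complex_hilbert \<Rightarrow> 'h) \<Rightarrow> 'h \<Rightarrow> 'h \<Rightarrow> 'g \<Rightarrow> complex" where
  "coeff U \<xi> \<eta> = (\<lambda>x. cinner (U x \<xi>) \<eta>)"

definition U_bounded :: "'g measure \<Rightarrow> ('g \<Rightarrow> 'h::complex_hilbert \<Rightarrow> 'h) \<Rightarrow> 'h \<Rightarrow> bool" where
  "U_bounded M U \<xi> \<longleftrightarrow> (\<exists>k. \<forall>\<eta>. square_integrable M (coeff U \<xi> \<eta>) \<and>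
       sqrt (L2_norm_sq M (coeff U \<xi> \<eta>)) \<le> k * norm \<eta>)"

definition bounded_vectors :: "'g measure \<Rightarrow> ('g \<Rightarrow> 'h::complex_hilbert \<Rightarrow> 'h) \<Rightarrow> 'h set" where
  "bounded_vectors M U = {\<xi>. U_bounded M U \<xi>}"

definition square_integrable_rep :: "'g measure \<Rightarrow> ('g \<Rightarrow> 'h::complex_hilbert \<Rightarrow> 'h) \<Rightarrow> bool" where
  "square_integrable_rep M U \<longleftrightarrow> closure (bounded_vectors M U) = UNIV"

text \<open>\<open>\<alpha>_x(a) = U_x a U_x^*\<close>; for a unitary representation \<open>U_x^* = U_{x\<inverse>}\<close>.\<close>
definition alpha :: "('g::group_add \<Rightarrow> 'h \<Rightarrow> 'h) \<Rightarrow> 'g \<Rightarrow> ('h \<Rightarrow> 'h) \<Rightarrow> 'h \<Rightarrow> 'h" where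
  "alpha U x a = U x \<circ> a \<circ> U (- x)"

definition has_weak_integral :: "'g measure \<Rightarrow> ('g \<Rightarrow> 'h::complex_hilbert) \<Rightarrow> 'h \<Rightarrow> bool" where
  "has_weak_integral M F v \<longleftrightarrow>
     (\<forall>\<theta>. integrable M (\<lambda>x. cinner \<theta> (F x)) \<and> cinner \<theta> v = (\<integral>x. cinner \<theta> (F x) \<partial>M))"

text \<open>Representatives of the elements \<open>\<lambda> \<in> L^\<infinity>(G)\<close> with compact support and \<open>0 \<le> \<lambda> \<le> 1\<close>;
ordered by a.e. comparison.\<close>
definition cutoffs :: "'g::topological_space measure \<Rightarrow> ('g \<Rightarrow> real) set" where
  "cutoffs M = {l. l \<in> borel_measurable M \<and> (\<forall>x. 0 \<le> l x \<and> l x \<le> 1) \<and>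
                   (\<exists>K. compact K \<and> (AE x in M. x \<notin> K \<longrightarrow> l x = 0))}"

text \<open>\<open>\<integral> F(x) dx = T\<close> as the strong-operator limit of \<open>\<integral> \<lambda>(x) F(x) dx\<close> along the
increasing net of cutoffs.\<close>
definition sot_integral :: "'g::topological_space measure \<Rightarrow> ('g \<Rightarrow> 'h \<Rightarrow> 'h::complex_hilbert)
    \<Rightarrow> ('h \<Rightarrow> 'h) \<Rightarrow> bool" where
  "sot_integral M F T \<longleftrightarrow>
     (\<forall>l\<in>cutoffs M. \<forall>\<omega>. \<exists>v. has_weak_integral M (\<lambda>x. l x *\<^sub>R F x \<omega>) v) \<and>
     (\<forall>\<omega> \<epsilon>. \<epsilon> > 0 \<longrightarrow> (\<exists>l0\<in>cutoffs M. \<forall>l\<in>cutoffs M. (AE x in M. l0 x \<le> l x) \<longrightarrow>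
        (\<forall>v. has_weak_integral M (\<lambda>x. l x *\<^sub>R F x \<omega>) v \<longrightarrow> norm (v - T \<omega>) < \<epsilon>)))"

end

theory Submission
  imports Defs
begin

text \<open>Applied to \<open>\<omega>\<close>, the integrand is \<open>c\<^sub>\<zeta>\<^sub>\<omega>(x) U\<^sub>x \<eta>\<close>, so the integral is \<open>T\<^sub>\<eta> T\<^sub>\<zeta>\<^sup>* \<omega>\<close>, and
  the cutoffs converge because \<open>c\<^sub>\<zeta>\<^sub>\<omega>\<close> is in \<open>L\<^sup>2\<close>. The form \<open>\<langle>T\<^sub>\<eta>\<^sup>* \<theta>, T\<^sub>\<zeta>\<^sup>* \<omega>\<rangle>\<close> is invariant under \<open>U\<close>, hence a
  multiple \<open>c \<langle>\<theta>, \<omega>\<rangle>\<close> of the inner product by Schur's lemma. The constant is found by setting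
  \<open>\<theta> = \<omega> = \<xi>\<close>: since \<open>c\<^sub>\<eta>\<^sub>\<xi>(x)\<close> is the conjugate of \<open>c\<^sub>\<xi>\<^sub>\<eta>(x\<inverse>)\<close>, the substitution
  \<open>\<integral> f(x\<inverse>) dx = \<integral> f(x) \<Delta>(x)\<inverse> dx\<close> turns \<open>c \<parallel>\<xi>\<parallel>\<^sup>2\<close> into
  \<open>\<langle>\<Delta>\<^sup>-\<^sup>1\<^sup>/\<^sup>2 T\<^sub>\<xi>\<^sup>* \<zeta>, \<Delta>\<^sup>-\<^sup>1\<^sup>/\<^sup>2 T\<^sub>\<xi>\<^sup>* \<eta>\<rangle>\<close>.\<close>

subsection \<open>Hilbert space\<close>

text \<open>Two obstacles shape the proof. For Schur's lemma, the spectral theorem is replaced by a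
  dichotomy: a symmetric intertwiner of an irreducible representation is positive or negative
  semidefinite. Applied to every real shift \<open>A - t\<close>, it squeezes the quadratic form of
  \<open>A\<close> to a single multiple of the squared norm. On the measure side, the group is not
  assumed second countable and \<open>M\<close> is not assumed sigma-finite. It is therefore applied
  only to continuous functions supported in compact rectangles; inner regularity then carries the
  inversion formula to all nonnegative continuous functions. This is enough because matrix
  coefficients are continuous. The operator T_\<eta> is never built on all of L2: its value at g is
  the vector that Riesz representation attaches to the pairing of g with the coefficients of
  \<eta>.\<close>

lemma cinner_add_left: "cinner (x + y) z = cinner x z + cinner y (z::'a::complex_hilbert)"
  by (metis cinner_add_right cinner_commute complex_cnj_add)

lemma cinner_scaleC_left: "cinner (a *\<^sub>C x) y = cnj a * cinner x (y::'a::complex_hilbert)"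
  by (metis cinner_commute cinner_scaleC_right complex_cnj_mult)

lemma scaleC_minus_one: "(-1) *\<^sub>C x = - (x::'a::complex_hilbert)"
  using scaleR_scaleC[of "-1" x] by simp

lemma cinner_minus_right: "cinner x (- y) = - cinner x (y::'a::complex_hilbert)"
  using cinner_scaleC_right[of x "-1" y] by (simp add: scaleC_minus_one)

lemma cinner_minus_left: "cinner (- x) y = - cinner x (y::'a::complex_hilbert)"
  using cinner_scaleC_left[of "-1" x y] by (simp add: scaleC_minus_one)

lemma cinner_diff_right: "cinner x (y - z) = cinner x y - cinner x (z::'a::complex_hilbert)"
  using cinner_add_right[of x y "- z"] by (simp add: cinner_minus_right)

lemma cinner_diff_left: "cinner (x - y) z = cinner x z - cinner y (z::'a::complex_hilbert)"
  using cinner_add_left[of x "- y" z] by (simp add: cinner_minus_left)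

lemma cinner_scaleR_right: "cinner x (r *\<^sub>R y) = of_real r * cinner x (y::'a::complex_hilbert)"
  by (simp add: scaleR_scaleC cinner_scaleC_right)

lemma cinner_scaleR_left: "cinner (r *\<^sub>R x) y = of_real r * cinner x (y::'a::complex_hilbert)"
  by (simp add: scaleR_scaleC cinner_scaleC_left)

lemmas cinner_bilinear_simps = cinner_add_left cinner_add_right cinner_diff_left cinner_diff_right
  cinner_scaleC_left cinner_scaleC_right cinner_scaleR_left cinner_scaleR_right
  cinner_minus_left cinner_minus_right

lemma norm_sq_eq_Re_cinner: "(norm x)\<^sup>2 = Re (cinner x (x::'a::complex_hilbert))"
  by (simp add: cinner_self_norm)

lemma Re_cinner_commute: "Re (cinner y x) = Re (cinner x (y::'a::complex_hilbert))"
  by (subst cinner_commute) simp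

lemma norm_add_sq_cinner:
  "(norm (x + y))\<^sup>2 = (norm x)\<^sup>2 + (norm y)\<^sup>2 + 2 * Re (cinner x (y::'a::complex_hilbert))"
  unfolding norm_sq_eq_Re_cinner
  by (simp add: cinner_bilinear_simps Re_cinner_commute[of y x])

lemma norm_diff_sq_cinner:
  "(norm (x - y))\<^sup>2 = (norm x)\<^sup>2 + (norm y)\<^sup>2 - 2 * Re (cinner x (y::'a::complex_hilbert))"
  unfolding norm_sq_eq_Re_cinner
  by (simp add: cinner_bilinear_simps Re_cinner_commute[of y x])

lemma norm_scaleC: "norm (a *\<^sub>C x) = cmod a * norm (x::'a::complex_hilbert)"
proof (rule power2_eq_imp_eq)
  have "complex_of_real ((norm (a *\<^sub>C x))\<^sup>2) = complex_of_real ((cmod a * norm x)\<^sup>2)"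
    unfolding cinner_self_norm[symmetric] power_mult_distrib of_real_mult complex_norm_square
    by (simp add: cinner_bilinear_simps algebra_simps)
  then show "(norm (a *\<^sub>C x))\<^sup>2 = (cmod a * norm x)\<^sup>2"
    using of_real_eq_iff by blast
qed auto

lemma cinner_eq_0_if_0 [simp]: "cinner x 0 = 0" "cinner 0 (x::'a::complex_hilbert) = 0"
  using cinner_minus_right[of x 0] cinner_minus_left[of 0 x] by (simp_all add: equal_neg_zero)

lemma cinner_Cauchy_Schwarz: "cmod (cinner x y) \<le> norm x * norm (y::'a::complex_hilbert)"
proof (cases "y = 0")
  case False
  define c where "c = cinner y x"
  \<comment> \<open>The vector is \<open>(norm y)\<^sup>2\<close> times the component of
    \<open>x\<close> orthogonal to \<open>y\<close>; this scaling avoids a division.\<close>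
  have "0 \<le> (norm ((norm y)\<^sup>2 *\<^sub>R x - c *\<^sub>C y))\<^sup>2" by simp
  also have "\<dots> = (norm y)^4 * (norm x)\<^sup>2 + (cmod c)\<^sup>2 * (norm y)\<^sup>2
      - 2 * (norm y)\<^sup>2 * (cmod c)\<^sup>2"
  proof -
    have "cinner x y = cnj c" unfolding c_def by (subst cinner_commute) simp
    then have "Re (cinner ((norm y)\<^sup>2 *\<^sub>R x) (c *\<^sub>C y)) = (norm y)\<^sup>2 * (cmod c)\<^sup>2"
      unfolding cinner_bilinear_simps
      by (simp add: cmod_power2 flip: power2_eq_square of_real_power)
         (simp add: algebra_simps power2_eq_square)
    then show ?thesis
      by (simp add: norm_diff_sq_cinner norm_scaleC power_mult_distrib)
  qed
  also have "\<dots> = (norm y)\<^sup>2 * ((norm y * norm x)\<^sup>2 - (cmod c)\<^sup>2)"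
    by (simp add: algebra_simps power2_eq_square power4_eq_xxxx)
  finally have "(cmod c)\<^sup>2 \<le> (norm y * norm x)\<^sup>2"
    using False by (simp add: zero_le_mult_iff)
  then have "cmod c \<le> norm y * norm x"
    by (rule power2_le_imp_le) simp
  moreover have "cmod (cinner x y) = cmod c"
    unfolding c_def by (subst cinner_commute) simp
  ultimately show ?thesis by (simp add: mult.commute)
qed simp

lemma Re_cinner_le: "\<bar>Re (cinner x y)\<bar> \<le> norm x * norm (y::'a::complex_hilbert)"
  using abs_Re_le_cmod cinner_Cauchy_Schwarz order_trans by blast

lemma cinner_ext:
  assumes "\<And>z. cinner z x = cinner z (y::'a::complex_hilbert)"
  shows "x = y"
proof -
  have "cinner (x - y) (x - y) = 0"
    using assms[of "x - y"] by (simp add: cinner_diff_right)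
  then show ?thesis by (simp add: cinner_self_norm)
qed

text \<open>Near 0 a nonzero linear term would dominate the quadratic one. This serves as the
  first-order condition at a minimiser.\<close>

lemma nonneg_quadratic_imp_linear_coeff_zero:
  fixes a b :: real
  assumes "\<And>t. 0 \<le> t\<^sup>2 * a + t * b"
  shows "b = 0"
proof (rule ccontr)
  assume b: "b \<noteq> 0"
  define s where "s = \<bar>a\<bar> + 1"
  have s: "s > 0" "a < s" unfolding s_def by auto
  have "0 \<le> (- b / s)\<^sup>2 * a + (- b / s) * b" by (rule assms)
  also have "\<dots> = (b / s)\<^sup>2 * (a - s)"
    using s by (simp add: field_simps power2_eq_square)
  also have "\<dots> < 0" using s b by (simp add: mult_pos_neg)
  finally show False by simp
qed

text \<open>The representing vector minimises \<open>\<parallel>x\<parallel>\<^sup>2 - 2 Re \<phi>(x)\<close>; a minimising sequence is Cauchy by the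
  parallelogram law.\<close>

lemma Riesz_representation:
  fixes \<phi> :: "'a::complex_hilbert \<Rightarrow> complex"
  assumes add: "\<And>x y. \<phi> (x + y) = \<phi> x + \<phi> y"
    and scale: "\<And>a x. \<phi> (a *\<^sub>C x) = a * \<phi> x"
    and bound: "\<And>x. cmod (\<phi> x) \<le> k * norm x"
  shows "\<exists>v. \<forall>x. \<phi> x = cinner v x"
proof -
  have scaleR: "\<phi> (r *\<^sub>R x) = of_real r * \<phi> x" for r x
    by (simp add: scaleR_scaleC scale)
  have "bounded_linear \<phi>"
    by (rule bounded_linear_intro[where K = k]) (auto simp: add scaleR scaleR_conv_of_real bound mult.commute)
  then have lim\<phi>: "(\<lambda>n. \<phi> (X n)) \<longlonglongrightarrow> \<phi> v" if "X \<longlonglongrightarrow> v" for X v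
    using bounded_linear.tendsto that by blast
  define E where "E x = (norm x)\<^sup>2 - 2 * Re (\<phi> x)" for x
  have "- k\<^sup>2 \<le> E x" for x
  proof -
    have "Re (\<phi> x) \<le> k * norm x"
      using bound[of x] complex_Re_le_cmod order_trans by blast
    moreover have "0 \<le> (norm x - k)\<^sup>2" by simp
    ultimately show ?thesis unfolding E_def by (simp add: power2_diff algebra_simps)
  qed
  then have bdd: "bdd_below (range E)" by (meson bdd_belowI2)
  define m where "m = Inf (range E)"
  have m_le: "m \<le> E x" for x
    unfolding m_def using bdd by (simp add: cInf_lower)
  have "\<exists>x. E x < m + 1 / Suc n" for n :: nat
    using cInf_lessD[of "range E" "m + 1 / Suc n"] by (auto simp: m_def)
  then obtain X where X: "\<And>n. E (X n) < m + 1 / Suc n" by metis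
  \<comment> \<open>The midpoint of \<open>x\<close> and \<open>y\<close> also has energy at least
    \<open>m\<close>, so two points of nearly minimal energy are close together.\<close>
  have dist_le: "(norm (x - y))\<^sup>2 \<le> 2 * (E x + E y - 2 * m)" for x y
  proof -
    have "E ((1/2) *\<^sub>R (x + y)) = (norm (x + y))\<^sup>2 / 4 - (Re (\<phi> x) + Re (\<phi> y))"
      unfolding E_def by (simp only: scaleR add norm_scaleR) (simp add: power_divide field_simps)
    then have "m \<le> (norm (x + y))\<^sup>2 / 4 - (Re (\<phi> x) + Re (\<phi> y))"
      using m_le by metis
    then show ?thesis
      unfolding E_def norm_add_sq_cinner norm_diff_sq_cinner by (simp add: field_simps)
  qed
  have "Cauchy X"
  proof (rule metric_CauchyI)
    fix e :: real assume e: "e > 0"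
    obtain N :: nat where N: "4 / e\<^sup>2 < real N" using reals_Archimedean2 by blast
    have "dist (X i) (X j) < e" if "i \<ge> N" "j \<ge> N" for i j
    proof -
      have s: "1 / Suc i \<le> 1 / Suc N" "1 / Suc j \<le> 1 / Suc N"
        using that by (auto simp: frac_le)
      have "(norm (X i - X j))\<^sup>2 \<le> 2 * (E (X i) + E (X j) - 2 * m)" by (rule dist_le)
      also have "\<dots> < 2 * (1 / Suc i + 1 / Suc j)" using X[of i] X[of j] by simp
      also have "\<dots> \<le> 4 / Suc N" using s by simp
      also have "\<dots> < e\<^sup>2" using N e by (simp add: field_simps pos_add_strict)
      finally show ?thesis using e by (simp add: dist_norm power2_less_imp_less)
    qed
    then show "\<exists>M. \<forall>i\<ge>M. \<forall>j\<ge>M. dist (X i) (X j) < e" by blast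
  qed
  then obtain v where v: "X \<longlonglongrightarrow> v" using Cauchy_convergent convergent_def by blast
  have "(\<lambda>n. E (X n)) \<longlonglongrightarrow> E v" unfolding E_def
    by (intro tendsto_intros lim\<phi> v)
  moreover have "(\<lambda>n. m + 1 / Suc n) \<longlonglongrightarrow> m + 0"
    by (intro tendsto_add tendsto_const LIMSEQ_Suc lim_1_over_n)
  ultimately have "E v \<le> m + 0"
    using X less_imp_le by (intro LIMSEQ_le) blast+
  then have Ev: "E v \<le> m" by simp
  \<comment> \<open>Along the line \<open>v + t x\<close> the energy is minimal at
    \<open>t = 0\<close>, so its linear coefficient in \<open>t\<close> vanishes.\<close>
  have Re_eq: "Re (\<phi> x) = Re (cinner v x)" for x
  proof -
    have "0 \<le> t\<^sup>2 * (norm x)\<^sup>2 + t * (2 * (Re (cinner v x) - Re (\<phi> x)))" for t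
    proof -
      have "E v \<le> E (v + t *\<^sub>R x)" using Ev m_le order_trans by blast
      then show ?thesis
        unfolding E_def norm_add_sq_cinner
        by (simp add: add scaleR cinner_bilinear_simps algebra_simps power_mult_distrib)
    qed
    then show ?thesis using nonneg_quadratic_imp_linear_coeff_zero by fastforce
  qed
  \<comment> \<open>The real part at \<open>\<i> *\<^sub>C x\<close> is minus the imaginary part at
    \<open>x\<close>.\<close>
  have "\<phi> x = cinner v x" for x
    using Re_eq[of x] Re_eq[of "\<i> *\<^sub>C x"]
    by (simp add: scale cinner_bilinear_simps complex_eq_iff)
  then show ?thesis by blast
qed

subsection \<open>Schur's lemma\<close>

text \<open>With \<open>B = 1 - A\<close> the limit \<open>R\<close> gives the square root \<open>1 - R\<close> of \<open>A\<close>. The scalar iteration with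
  \<open>B = 1\<close> majorises the operator iteration.\<close>

lemma operator_square_root_iteration:
  fixes B :: "'a::banach \<Rightarrow>\<^sub>L 'a"
  assumes B: "norm B \<le> 1"
  obtains R where "norm R \<le> 1" "2 *\<^sub>R R = B + (R o\<^sub>L R)"
    "\<And>C. C o\<^sub>L B = B o\<^sub>L C \<Longrightarrow> C o\<^sub>L R = R o\<^sub>L C"
proof -
  note simps = bounded_bilinear.add_left[OF bounded_bilinear_blinfun_compose]
    bounded_bilinear.add_right[OF bounded_bilinear_blinfun_compose]
    bounded_bilinear.diff_left[OF bounded_bilinear_blinfun_compose]
    bounded_bilinear.diff_right[OF bounded_bilinear_blinfun_compose]
    bounded_bilinear.scaleR_left[OF bounded_bilinear_blinfun_compose]
    bounded_bilinear.scaleR_right[OF bounded_bilinear_blinfun_compose]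
  have assoc: "(X o\<^sub>L Y) o\<^sub>L Z = X o\<^sub>L (Y o\<^sub>L Z)" for X Y Z :: "'a \<Rightarrow>\<^sub>L 'a"
    by (rule blinfun_eqI) simp
  \<comment> \<open>The iteration aims at a fixed point \<open>2 R = B + R R\<close>, which is the
    same as (1 - R)^2 = 1 - B.\<close>
  define R where "R = rec_nat (0 :: 'a \<Rightarrow>\<^sub>L 'a) (\<lambda>_ X. (1/2) *\<^sub>R (B + (X o\<^sub>L X)))"
  define r where "r = rec_nat (0 :: real) (\<lambda>_ x. (1/2) * (1 + x * x))"
  have R0: "R 0 = 0" and RS: "R (Suc n) = (1/2) *\<^sub>R (B + (R n o\<^sub>L R n))" for n
    by (simp_all add: R_def)
  have r0: "r 0 = 0" and rS: "r (Suc n) = (1/2) * (1 + r n * r n)" for n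
    by (simp_all add: r_def)
  have r01: "0 \<le> r n \<and> r n \<le> 1" for n
  proof (induction n)
    case (Suc n)
    then have "r n * r n \<le> 1 * 1" by (intro mult_mono) auto
    then show ?case by (simp add: rS)
  qed (simp add: r0)
  have comm: "C o\<^sub>L R n = R n o\<^sub>L C" if "C o\<^sub>L B = B o\<^sub>L C" for C n
  proof (induction n)
    case (Suc n)
    have "C o\<^sub>L (R n o\<^sub>L R n) = (R n o\<^sub>L R n) o\<^sub>L C"
      by (metis Suc assoc)
    then show ?case using that by (simp add: RS simps)
  qed (simp add: R0)
  \<comment> \<open>Two uses of \<open>comm\<close>: with \<open>C = B\<close> it shows that
    \<open>B\<close> commutes with \<open>R m\<close>, which then makes \<open>C = R m\<close>
    admissible.\<close>
  have commRR: "R m o\<^sub>L R n = R n o\<^sub>L R m" for m n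
    using comm by metis
  have normR: "norm (R n) \<le> r n" for n
  proof (induction n)
    case (Suc n)
    have "norm (R n o\<^sub>L R n) \<le> r n * r n"
      using Suc norm_blinfun_compose[of "R n" "R n"] r01[of n]
      by (meson mult_mono norm_ge_zero order_trans)
    then have "norm (B + (R n o\<^sub>L R n)) \<le> 1 + r n * r n"
      using B norm_triangle_mono by blast
    then show ?case by (simp add: RS rS)
  qed (simp add: R0 r0)
  \<comment> \<open>As the iterates commute, a difference of squares factors as in the scalar case,
    and each factor is dominated by its scalar counterpart. The increments of \<open>R\<close> then
    telescope against those of the convergent sequence \<open>r\<close>.\<close>
  have step: "norm (R (Suc n) - R n) \<le> r (Suc n) - r n" for n
  proof (induction n)
    case 0
    show ?case using B by (simp add: RS R0 rS r0)
  next
    case (Suc n)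
    let ?D = "R (Suc n) - R n" and ?P = "R (Suc n) + R n"
    have "R (Suc (Suc n)) - R (Suc n) = (1/2) *\<^sub>R ((R (Suc n) o\<^sub>L R (Suc n)) - (R n o\<^sub>L R n))"
      unfolding RS[of "Suc n"] by (subst (3) RS) (simp add: algebra_simps)
    also have "(R (Suc n) o\<^sub>L R (Suc n)) - (R n o\<^sub>L R n) = ?D o\<^sub>L ?P"
      by (simp add: simps commRR[of "Suc n" n])
    finally have "norm (R (Suc (Suc n)) - R (Suc n)) = (1/2) * norm (?D o\<^sub>L ?P)" by simp
    also have "norm (?D o\<^sub>L ?P) \<le> norm ?D * norm ?P" by (rule norm_blinfun_compose)
    also have "\<dots> \<le> (r (Suc n) - r n) * (r (Suc n) + r n)"
      using Suc normR[of n] normR[of "Suc n"] order_trans[OF norm_ge_zero Suc]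
      by (intro mult_mono) (auto intro: norm_triangle_mono)
    also have "(1/2) * \<dots> = r (Suc (Suc n)) - r (Suc n)"
      unfolding rS[of "Suc n"] by (subst (4) rS) (simp add: algebra_simps)
    finally show ?case by simp
  qed
  have dist: "norm (R (n + j) - R n) \<le> r (n + j) - r n" for n j
  proof (induction j)
    case (Suc j)
    have "norm (R (n + Suc j) - R n) \<le> norm (R (Suc (n+j)) - R (n+j)) + norm (R (n + j) - R n)"
      using norm_triangle_ineq[of "R (Suc (n+j)) - R (n+j)" "R (n + j) - R n"] by simp
    then show ?case using Suc step[of "n+j"] by simp
  qed simp
  have "incseq r"
    by (rule incseq_SucI) (use order_trans[OF norm_ge_zero step] in simp)
  then have "convergent r" using r01 incseq_convergent[of r 1] convergent_def by blast
  then have Cr: "Cauchy r" by (rule convergent_Cauchy)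
  have "Cauchy R"
  proof (rule metric_CauchyI)
    fix e :: real assume "e > 0"
    then obtain N where N: "\<And>i j. i \<ge> N \<Longrightarrow> j \<ge> N \<Longrightarrow> dist (r i) (r j) < e"
      using Cr metric_CauchyD by metis
    have "dist (R i) (R j) < e" if "i \<ge> N" "j \<ge> N" for i j
    proof -
      have *: "dist (R j) (R i) < e" if "i \<ge> N" "j \<ge> i" for i j
        using dist[of i "j - i"] N[of j i] that by (simp add: dist_norm)
      show ?thesis using *[of i j] *[of j i] that by (cases "i \<le> j") (auto simp: dist_commute)
    qed
    then show "\<exists>M. \<forall>i\<ge>M. \<forall>j\<ge>M. dist (R i) (R j) < e" by blast
  qed
  then obtain L where L: "R \<longlonglongrightarrow> L" using Cauchy_convergent convergent_def by blast
  note lim = bounded_bilinear.tendsto[OF bounded_bilinear_blinfun_compose]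
  show thesis
  proof
    show "norm L \<le> 1"
      using normR r01 by (intro LIMSEQ_le_const2[OF tendsto_norm[OF L]]) (meson order_trans)
    have "(\<lambda>n. 2 *\<^sub>R R (Suc n)) \<longlonglongrightarrow> 2 *\<^sub>R L"
      by (intro tendsto_intros LIMSEQ_Suc L)
    moreover have "(\<lambda>n. B + (R n o\<^sub>L R n)) \<longlonglongrightarrow> B + (L o\<^sub>L L)"
      by (intro tendsto_add tendsto_const lim L)
    ultimately show "2 *\<^sub>R L = B + (L o\<^sub>L L)"
      by (simp add: RS LIMSEQ_unique)
    show "C o\<^sub>L L = L o\<^sub>L C" if "C o\<^sub>L B = B o\<^sub>L C" for C
    proof (rule LIMSEQ_unique)
      show "(\<lambda>n. C o\<^sub>L R n) \<longlonglongrightarrow> (C o\<^sub>L L)" by (intro lim tendsto_const L)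
      have "(\<lambda>n. R n o\<^sub>L C) \<longlonglongrightarrow> (L o\<^sub>L C)" by (intro lim tendsto_const L)
      then show "(\<lambda>n. C o\<^sub>L R n) \<longlonglongrightarrow> (L o\<^sub>L C)" by (simp add: comm[OF that])
    qed
  qed
qed

section \<open>Unitary representations and their intertwiners\<close>

lemma unitary_rep_simps:
  assumes "unitary_rep U"
  shows "U x (v + w) = U x v + U x w" "U x (a *\<^sub>C v) = a *\<^sub>C U x v"
    "cinner (U x v) (U x w) = cinner v w" "U (x + y) v = U x (U y v)" "U 0 v = v"
  using assms by (auto simp: unitary_rep_def unitary_op_def clinear_map_def)

lemma unitary_rep_norm: "unitary_rep U \<Longrightarrow> norm (U x v) = norm v"
  by (rule power2_eq_imp_eq) (auto simp: norm_sq_eq_Re_cinner unitary_rep_simps)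

lemma unitary_rep_bounded_linear: "unitary_rep U \<Longrightarrow> bounded_linear (U x)"
  by (rule bounded_linear_intro[where K = 1])
     (auto simp: unitary_rep_simps scaleR_scaleC unitary_rep_norm)

lemma unitary_rep_adjoint:
  assumes "unitary_rep U"
  shows "cinner (U x v) w = cinner v (U (- x) w)"
  using unitary_rep_simps(3-5)[OF assms] by (metis add.right_inverse)

lemma bounded_linear_scaleC: "bounded_linear (\<lambda>v::'a::complex_hilbert. a *\<^sub>C v)"
  by (rule bounded_linear_intro[where K = "cmod a"])
     (auto simp: scaleC_add_right scaleR_scaleC scaleC_scaleC norm_scaleC mult.commute)

lemma scaleC_diff_right: "a *\<^sub>C (x - y) = a *\<^sub>C x - a *\<^sub>C (y::'a::complex_hilbert)"
  by (rule linear_diff[OF bounded_linear.linear[OF bounded_linear_scaleC]])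

lemma unitary_rep_diff: "unitary_rep U \<Longrightarrow> U x (v - w) = U x v - U x w"
  by (rule linear_diff[OF bounded_linear.linear[OF unitary_rep_bounded_linear]])

text \<open>Elements of the type of bounded linear maps are only real-linear, so complex homogeneity
  is demanded explicitly.\<close>

definition intertwines :: "('g \<Rightarrow> 'h::complex_hilbert \<Rightarrow> 'h) \<Rightarrow> ('h \<Rightarrow>\<^sub>L 'h) \<Rightarrow> bool" where
  "intertwines U A \<longleftrightarrow> (\<forall>a v. A (a *\<^sub>C v) = a *\<^sub>C A v) \<and> (\<forall>x v. A (U x v) = U x (A v))"

text \<open>With \<open>S = \<bar>A\<bar>\<close> we have \<open>(S + A)(S - A) = 0\<close>, and the kernel of \<open>S + A\<close> is invariant.\<close>

lemma intertwiner_semidefinite_of_norm_le_1: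
  fixes A :: "'h::complex_hilbert \<Rightarrow>\<^sub>L 'h"
  assumes rep: "unitary_rep U" and irred: "irreducible_rep U" and int: "intertwines U A"
    and sym: "\<And>v w. cinner (A v) w = cinner v (A w)" and norm: "norm A \<le> 1"
  shows "(\<forall>v. 0 \<le> Re (cinner v (A v))) \<or> (\<forall>v. Re (cinner v (A v)) \<le> 0)"
proof -
  have contr: "norm (A v) \<le> norm v" for v
    using norm_blinfun[of A v] norm mult_right_mono[OF norm, of "norm v"] by simp
  \<comment> \<open>For symmetric contractive \<open>A\<close>, expanding the square gives
    \<open>norm (B v)\<close> at most \<open>norm v\<close>, because the cross term outweighs the
    norm of \<open>A (A v)\<close>.\<close>
  define B where "B = id_blinfun - (A o\<^sub>L A)"
  have Bv: "B v = v - A (A v)" for v by (simp add: B_def blinfun.diff_left)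
  have "norm (B v) \<le> 1 * norm v" for v
  proof -
    have "(norm (B v))\<^sup>2 = (norm v)\<^sup>2 + (norm (A (A v)))\<^sup>2 - 2 * (norm (A v))\<^sup>2"
      unfolding Bv norm_diff_sq_cinner by (simp add: sym norm_sq_eq_Re_cinner[of "A v"])
    moreover have "(norm (A (A v)))\<^sup>2 \<le> (norm (A v))\<^sup>2" by (simp add: contr power_mono)
    ultimately have "(norm (B v))\<^sup>2 \<le> (norm v)\<^sup>2" by (smt (verit) zero_le_power2)
    then have "norm (B v) \<le> norm v" by (rule power2_le_imp_le) simp
    then show ?thesis by simp
  qed
  then have "norm B \<le> 1" by (rule norm_blinfun_bound[rotated]) simp
  then obtain R where R: "norm R \<le> 1" "2 *\<^sub>R R = B + (R o\<^sub>L R)"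
    and comm: "\<And>C. C o\<^sub>L B = B o\<^sub>L C \<Longrightarrow> C o\<^sub>L R = R o\<^sub>L C"
    using operator_square_root_iteration by blast
  \<comment> \<open>Whatever commutes with \<open>A\<close> commutes with \<open>R\<close>. Taking
    multiplication by a complex scalar for \<open>c\<close> shows that \<open>R\<close> is
    complex-linear; taking \<open>U x\<close> and \<open>A\<close> gives the other two relations
    needed.\<close>
  have comm': "c (R v) = R (c v)" if c: "bounded_linear c" and cA: "\<And>v. c (A v) = A (c v)" for c v
  proof -
    have ap: "blinfun_apply (Blinfun c) = c" using c by (rule bounded_linear_Blinfun_apply)
    have "Blinfun c o\<^sub>L B = B o\<^sub>L Blinfun c"
      by (rule blinfun_eqI) (simp add: ap Bv linear_diff[OF bounded_linear.linear[OF c]] cA)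
    then have "Blinfun c o\<^sub>L R = R o\<^sub>L Blinfun c" by (rule comm)
    then have "(Blinfun c o\<^sub>L R) v = (R o\<^sub>L Blinfun c) v" by simp
    then show ?thesis by (simp add: ap)
  qed
  have RU: "U x (R v) = R (U x v)" for x v
    using int by (intro comm' unitary_rep_bounded_linear rep) (simp add: intertwines_def)
  have RC: "a *\<^sub>C R v = R (a *\<^sub>C v)" for a v
    using int by (intro comm' bounded_linear_scaleC) (simp add: intertwines_def)
  have RA: "A (R v) = R (A v)" for v
    by (intro comm' blinfun.bounded_linear_right) simp
  define S where "S v = v - R v" for v
  have S_pos: "0 \<le> Re (cinner v (S v))" for v
  proof -
    have "norm (R v) \<le> norm v"
      using norm_blinfun[of R v] mult_right_mono[OF R(1), of "norm v"] by simp
    then have "Re (cinner v (R v)) \<le> norm v * norm v"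
      using Re_cinner_le[of v "R v"] mult_left_mono[of "norm (R v)" "norm v" "norm v"] by simp
    then show ?thesis
      by (simp add: S_def cinner_bilinear_simps power2_eq_square flip: norm_sq_eq_Re_cinner)
  qed
  \<comment> \<open>With \<open>S = 1 - R\<close> the fixed-point equation reads S^2 = 1 - B = A^2;
    together with \<open>S_pos\<close> this makes \<open>S\<close> the absolute value of
    \<open>A\<close>.\<close>
  have SS: "S (S v) = A (A v)" for v
  proof -
    have "blinfun_apply (2 *\<^sub>R R) v = blinfun_apply (B + (R o\<^sub>L R)) v" using R(2) by simp
    then have "2 *\<^sub>R R v = B v + R (R v)" by (simp add: blinfun.scaleR_left blinfun.add_left)
    then show ?thesis
      by (simp add: S_def blinfun.diff_right Bv scaleR_2 algebra_simps)
  qed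
  define N where "N = {v. S v + A v = 0}"
  have "continuous_on UNIV (\<lambda>v. S v + A v)"
    unfolding S_def by (intro continuous_intros)
  then have "closed N"
    unfolding N_def by (rule closed_Collect_eq) (rule continuous_on_const)
  moreover define T where "T v = S v + A v" for v
  have T: "T 0 = 0" "T (x + y) = T x + T y" "T (a *\<^sub>C x) = a *\<^sub>C T x" "T (U g x) = U g (T x)"
    for x y a g
    using int unfolding intertwines_def
    by (simp_all add: T_def S_def blinfun.add_right RU RC scaleC_diff_right scaleC_add_right
        unitary_rep_diff[OF rep] unitary_rep_simps(1)[OF rep])
  moreover have "U x 0 = 0" "a *\<^sub>C (0::'h) = 0" for x a
    using unitary_rep_diff[OF rep, of x 0 0] scaleC_diff_right[of a 0 "0::'h"] by simp_all
  moreover have "N = {v. T v = 0}" by (simp add: N_def T_def)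
  ultimately have "closed_csubspace N \<and> (\<forall>x. U x ` N \<subseteq> N)"
    unfolding closed_csubspace_def by auto
  \<comment> \<open>A trivial kernel of \<open>S + A\<close> forces \<open>A = S\<close>, a full one
    forces \<open>A = - S\<close>; the sign of \<open>A\<close> follows from that of
    \<open>S\<close>.\<close>
  then consider "N = {0}" | "N = UNIV"
    using irred unfolding irreducible_rep_def by blast
  then show ?thesis
  proof cases
    case 1
    have "S w - A w \<in> N" for w
    proof -
      have "A (S w) = S (A w)" by (simp add: S_def blinfun.diff_right RA)
      moreover have "S (S w - A w) = S (S w) - S (A w)"
        by (simp add: S_def[of "S w - A w"] S_def[of "S w"] S_def[of "A w"] blinfun.diff_right)
      ultimately show ?thesis by (simp add: N_def blinfun.diff_right SS)
    qed
    then have "A w = S w" for w using 1 by auto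
    then show ?thesis using S_pos by simp
  next
    case 2
    then have "A w = - S w" for w
      unfolding N_def by (metis (mono_tags) UNIV_I add.commute add_eq_0_iff mem_Collect_eq)
    then show ?thesis using S_pos by (simp add: cinner_bilinear_simps)
  qed
qed

text \<open>A positive factor changes no sign, so \<open>A\<close> may be shrunk to a contraction.
  The summand 1 in \<open>norm A + 1\<close> keeps the factor defined when
  \<open>A = 0\<close>.\<close>

lemma intertwiner_semidefinite:
  fixes A :: "'h::complex_hilbert \<Rightarrow>\<^sub>L 'h"
  assumes rep: "unitary_rep U" and irred: "irreducible_rep U" and int: "intertwines U A"
    and sym: "\<And>v w. cinner (A v) w = cinner v (A w)"
  shows "(\<forall>v. 0 \<le> Re (cinner v (A v))) \<or> (\<forall>v. Re (cinner v (A v)) \<le> 0)"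
proof -
  define s where "s = inverse (norm A + 1)"
  have s: "s > 0" by (simp add: s_def add_nonneg_pos)
  have comm: "s *\<^sub>R (a *\<^sub>C v) = a *\<^sub>C (s *\<^sub>R (v::'h))" "s *\<^sub>R U x v = U x (s *\<^sub>R v)" for a x v
    by (simp_all add: scaleR_scaleC scaleC_scaleC mult.commute unitary_rep_simps[OF rep])
  have "norm (s *\<^sub>R A) \<le> 1"
    using s by (simp add: s_def field_simps add_nonneg_pos)
  moreover have "intertwines U (s *\<^sub>R A)"
    using int by (simp add: intertwines_def blinfun.scaleR_left comm)
  ultimately show ?thesis
    using intertwiner_semidefinite_of_norm_le_1[OF rep irred, of "s *\<^sub>R A"] sym s
    by (simp add: blinfun.scaleR_left cinner_bilinear_simps zero_le_mult_iff mult_le_0_iff)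
qed

text \<open>Each real \<open>t\<close> is a lower or an upper bound of the Rayleigh quotients of
  \<open>A\<close>, by the dichotomy for \<open>A - t\<close>. Hence these quotients all equal one
  number, and a symmetric operator with vanishing quadratic form is zero.\<close>

lemma symmetric_intertwiner_scalar:
  fixes A :: "'h::complex_hilbert \<Rightarrow>\<^sub>L 'h"
  assumes rep: "unitary_rep U" and irred: "irreducible_rep U" and int: "intertwines U A"
    and sym: "\<And>v w. cinner (A v) w = cinner v (A w)"
  shows "\<exists>t. \<forall>v. A v = t *\<^sub>R v"
proof -
  obtain e :: 'h where e: "e \<noteq> 0" using irred by (auto simp: irreducible_rep_def)
  \<comment> \<open>\<open>W\<close> is the set of lower bounds of the Rayleigh quotients; its
    supremum \<open>t0\<close> will be the scalar.\<close>
  define W where "W = {t. \<forall>v. t * (norm v)\<^sup>2 \<le> Re (cinner v (A v))}"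
  have ap: "(A - t *\<^sub>R id_blinfun) v = A v - t *\<^sub>R v" for t v
    by (simp add: blinfun.diff_left blinfun.scaleR_left)
  have comm: "t *\<^sub>R (a *\<^sub>C v) = a *\<^sub>C (t *\<^sub>R (v::'h))" "t *\<^sub>R U x v = U x (t *\<^sub>R v)" for t a x v
    by (simp_all add: scaleR_scaleC scaleC_scaleC mult.commute unitary_rep_simps[OF rep])
  have semidef: "(\<forall>v. t * (norm v)\<^sup>2 \<le> Re (cinner v (A v))) \<or> (\<forall>v. Re (cinner v (A v)) \<le> t * (norm v)\<^sup>2)"
    for t
  proof -
    have "intertwines U (A - t *\<^sub>R id_blinfun)"
      using int by (simp add: intertwines_def ap comm scaleC_diff_right unitary_rep_diff[OF rep])
    then show ?thesis
      using intertwiner_semidefinite[OF rep irred, of "A - t *\<^sub>R id_blinfun"] sym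
      by (simp add: ap cinner_bilinear_simps flip: norm_sq_eq_Re_cinner)
  qed
  have bnd: "\<bar>Re (cinner v (A v))\<bar> \<le> norm A * (norm v)\<^sup>2" for v
    using Re_cinner_le[of v "A v"] mult_left_mono[OF norm_blinfun[of A v] norm_ge_zero[of v]]
    by (simp add: power2_eq_square algebra_simps)
  have "- norm A \<in> W" unfolding W_def using bnd by (auto simp: abs_le_iff minus_le_iff)
  then have ne: "W \<noteq> {}" by blast
  have le: "t \<le> Re (cinner v (A v)) / (norm v)\<^sup>2" if "t \<in> W" "v \<noteq> 0" for t v
    using that by (simp add: W_def pos_le_divide_eq)
  have bdd: "bdd_above W" using le e by (meson bdd_aboveI)
  define t0 where "t0 = Sup W"
  have low: "t0 * (norm v)\<^sup>2 \<le> Re (cinner v (A v))" for v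
  proof (cases "v = 0")
    case False
    then have "t0 \<le> Re (cinner v (A v)) / (norm v)\<^sup>2"
      unfolding t0_def using le ne by (intro cSup_least) auto
    then show ?thesis using False by (simp add: pos_le_divide_eq)
  qed simp
  have up: "Re (cinner v (A v)) \<le> t0 * (norm v)\<^sup>2" for v
  proof (cases "v = 0")
    case False
    have "Re (cinner v (A v)) / (norm v)\<^sup>2 \<le> t0"
    \<comment> \<open>A number above \<open>t0\<close> is not a lower bound, so by
      \<open>semidef\<close> it is an upper bound; let it decrease to \<open>t0\<close>.\<close>
    proof (rule dense_ge)
      fix t assume "t > t0"
      then have "t \<notin> W" unfolding t0_def using bdd cSup_upper not_le by blast
      then show "Re (cinner v (A v)) / (norm v)\<^sup>2 \<le> t"
        using semidef[of t] False by (auto simp: W_def pos_divide_le_eq)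
    qed
    then show ?thesis using False by (simp add: pos_divide_le_eq)
  qed simp
  define D where "D v = A v - t0 *\<^sub>R v" for v
  have D0: "Re (cinner v (D v)) = 0" for v
    using low[of v] up[of v] by (simp add: D_def cinner_bilinear_simps flip: norm_sq_eq_Re_cinner)
  have D_sym: "cinner v (D w) = cinner (D v) w" for v w
    by (simp add: D_def cinner_bilinear_simps sym)
  \<comment> \<open>Polarisation in the direction \<open>D v\<close> itself: by symmetry both cross
    terms equal the squared norm of \<open>D v\<close>.\<close>
  have "D v = 0" for v
  proof -
    let ?w = "D v"
    have "D (v + ?w) = D v + D ?w" by (simp add: D_def blinfun.add_right blinfun.diff_right algebra_simps)
    then have "Re (cinner v (D ?w)) + Re (cinner ?w (D v)) = 0"
      using D0[of "v + ?w"] D0[of v] D0[of ?w] by (simp add: cinner_bilinear_simps)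
    moreover have "cinner v (D ?w) = cinner (D v) ?w"
      by (rule D_sym)
    ultimately have "(norm (D v))\<^sup>2 = 0" by (simp add: norm_sq_eq_Re_cinner)
    then show ?thesis by simp
  qed
  then show ?thesis by (auto simp: D_def)
qed

section \<open>Invariant sesquilinear forms\<close>

definition bounded_sesquilinear :: "('h::complex_hilbert \<Rightarrow> 'h \<Rightarrow> complex) \<Rightarrow> bool" where
  "bounded_sesquilinear Q \<longleftrightarrow>
     (\<forall>x y z. Q (x + y) z = Q x z + Q y z) \<and> (\<forall>x y z. Q x (y + z) = Q x y + Q x z) \<and>
     (\<forall>a x y. Q (a *\<^sub>C x) y = cnj a * Q x y) \<and> (\<forall>a x y. Q x (a *\<^sub>C y) = a * Q x y) \<and>
     (\<exists>k. \<forall>x y. cmod (Q x y) \<le> k * norm x * norm y)"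

text \<open>Riesz representation turns the form into an operator \<open>A\<close>. Hermitian
  symmetry makes \<open>A\<close> symmetric, invariance makes it an intertwiner, and the operator
  version of Schur's lemma applies.\<close>

lemma invariant_hermitian_form_scalar:
  fixes Q :: "'h::complex_hilbert \<Rightarrow> 'h \<Rightarrow> complex"
  assumes rep: "unitary_rep U" and irred: "irreducible_rep U" and Q: "bounded_sesquilinear Q"
    and inv: "\<And>x v w. Q (U x v) (U x w) = Q v w" and herm: "\<And>v w. Q w v = cnj (Q v w)"
  shows "\<exists>c. \<forall>v w. Q v w = c * cinner v w"
proof -
  obtain k where k: "\<And>x y. cmod (Q x y) \<le> k * norm x * norm y"
    using Q by (auto simp: bounded_sesquilinear_def)
  have "\<exists>u. \<forall>v. Q w v = cinner u v" for w
    using Q k[of w] by (intro Riesz_representation[where k = "k * norm w"])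
      (auto simp: bounded_sesquilinear_def)
  then obtain A where A: "\<And>w v. Q w v = cinner (A w) v" by metis
  have A': "Q v w = cinner v (A w)" for v w
    by (metis A cinner_commute herm)
  have lin: "A (x + y) = A x + A y" "A (a *\<^sub>C x) = a *\<^sub>C A x" for x y a
    using Q by (rule_tac [!] cinner_ext)
      (simp_all add: cinner_add_right cinner_scaleC_right bounded_sesquilinear_def flip: A')
  have bl: "bounded_linear A"
  proof (rule bounded_linear_intro[where K = "\<bar>k\<bar>"])
    fix x
    have "norm (A x) * norm (A x) = cmod (Q x (A x))"
      by (simp add: A cinner_self_norm power2_eq_square norm_mult)
    also have "\<dots> \<le> \<bar>k\<bar> * norm x * norm (A x)"
      using k[of x "A x"] by (smt (verit) mult_right_mono norm_ge_zero abs_ge_self)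
    finally show "norm (A x) \<le> norm x * \<bar>k\<bar>"
      by (cases "A x = 0") (auto simp: mult.commute)
  qed (auto simp: lin scaleR_scaleC)
  have "A (U x v) = U x (A v)" for x v
  proof (rule cinner_ext)
    fix z
    \<comment> \<open>Writing \<open>z\<close> as a value of \<open>U x\<close> allows the
      invariance of \<open>Q\<close> to be used in both arguments at once.\<close>
    have z: "U x (U (- x) z) = z"
      using unitary_rep_simps(4,5)[OF rep] by (metis add.right_inverse)
    have "cinner z (A (U x v)) = Q (U x (U (- x) z)) (U x v)" by (simp only: A' z)
    also have "\<dots> = cinner (U (- x) z) (A v)" by (simp only: inv) (rule A')
    also have "\<dots> = cinner (U x (U (- x) z)) (U x (A v))" by (simp add: unitary_rep_simps[OF rep])
    finally show "cinner z (A (U x v)) = cinner z (U x (A v))" by (simp add: z)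
  qed
  then have "intertwines U (Blinfun A)"
    by (simp add: intertwines_def lin bounded_linear_Blinfun_apply[OF bl])
  moreover have "cinner (A v) w = cinner v (A w)" for v w by (metis A A')
  ultimately obtain t where "\<And>v. A v = t *\<^sub>R v"
    using symmetric_intertwiner_scalar[OF rep irred, of "Blinfun A"]
    by (auto simp: bounded_linear_Blinfun_apply[OF bl])
  then show ?thesis by (auto simp: A' cinner_bilinear_simps)
qed

lemma invariant_form_scalar:
  fixes Q :: "'h::complex_hilbert \<Rightarrow> 'h \<Rightarrow> complex"
  assumes rep: "unitary_rep U" and irred: "irreducible_rep U" and Q: "bounded_sesquilinear Q"
    and inv: "\<And>x v w. Q (U x v) (U x w) = Q v w"
  shows "\<exists>c. \<forall>v w. Q v w = c * cinner v w"
proof -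
  define P where "P a v w = a * Q v w + cnj a * cnj (Q w v)" for a v w
  obtain k where k: "\<And>x y. cmod (Q x y) \<le> k * norm x * norm y"
    using Q by (auto simp: bounded_sesquilinear_def)
  have "\<exists>c. \<forall>v w. P a v w = c * cinner v w" if a: "cmod a = 1" for a
  proof (rule invariant_hermitian_form_scalar[OF rep irred])
    have "cmod (P a x y) \<le> (2 * k) * norm x * norm y" for x y
      using norm_triangle_ineq[of "a * Q x y" "cnj a * cnj (Q y x)"] k[of x y] k[of y x] a
      by (simp add: P_def norm_mult mult.commute mult.left_commute)
    then show "bounded_sesquilinear (P a)"
      using Q unfolding bounded_sesquilinear_def
      by (intro conjI exI[of _ "2 * k"]) (auto simp: P_def algebra_simps)
  qed (auto simp: P_def inv)
  from this[of 1] this[of \<i>] obtain c d where "\<And>v w. P 1 v w = c * cinner v w"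
    "\<And>v w. P \<i> v w = d * cinner v w" by auto
  moreover have "Q v w = (P 1 v w - \<i> * P \<i> v w) / 2" for v w
    by (simp add: P_def algebra_simps)
  ultimately have "Q v w = ((c - \<i> * d) / 2) * cinner v w" for v w
    by (simp add: field_simps)
  then show ?thesis by blast
qed

subsection \<open>Haar measure and inversion\<close>

text \<open>Without countable bases an open subset of the product need not lie in the product
  sigma-algebra. Compactness replaces countability: a closed superlevel set is compact, so finitely
  many open boxes cover it inside any slightly larger superlevel set.\<close>

lemma borel_measurable_continuous_on_compact_rectangle:
  fixes h :: "'a::topological_space \<times> 'b::topological_space \<Rightarrow> real"
  assumes K: "compact K" and L: "compact L" and h: "continuous_on (K \<times> L) h"
  shows "h \<in> borel_measurable (restrict_space borel K \<Otimes>\<^sub>M restrict_space borel L)"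
    (is "h \<in> borel_measurable ?P")
proof -
  have spP: "space ?P = K \<times> L"
    by (simp add: space_pair_measure space_restrict_space)
  have "{w \<in> space ?P. a \<le> h w} \<in> sets ?P" for a
  proof -
    define C where "C = {w \<in> K \<times> L. a \<le> h w}"
    have "closedin (top_of_set (K \<times> L)) (K \<times> L \<inter> h -` {a..})"
      using h by (intro continuous_closedin_preimage) auto
    then have "compact (K \<times> L \<inter> h -` {a..})"
      using compact_Times[OF K L] closedin_compact by blast
    moreover have "K \<times> L \<inter> h -` {a..} = C" by (auto simp: C_def)
    ultimately have C: "compact C" by simp
    have "\<exists>R. R \<in> sets ?P \<and> C \<subseteq> R \<and> R \<subseteq> {w \<in> K \<times> L. a - e < h w}" if e: "e > 0" for e
    proof -
      have "openin (top_of_set (K \<times> L)) (K \<times> L \<inter> h -` {a - e<..})"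
        using h by (intro continuous_openin_preimage_gen) auto
      then obtain T where T: "open T" "K \<times> L \<inter> h -` {a - e<..} = K \<times> L \<inter> T"
        by (auto simp: openin_open)
      have "\<exists>A B. open A \<and> open B \<and> w \<in> A \<times> B \<and> A \<times> B \<subseteq> T" if "w \<in> C" for w
      proof -
        have "w \<in> T" using that T(2) e by (auto simp: C_def)
        then show ?thesis using open_prod_elim[OF T(1)] by metis
      qed
      then obtain A B where AB: "\<And>w. w \<in> C \<Longrightarrow> open (A w) \<and> open (B w) \<and> w \<in> A w \<times> B w \<and> A w \<times> B w \<subseteq> T"
        by metis
      obtain D where D: "D \<subseteq> C" "finite D" "C \<subseteq> (\<Union>w\<in>D. A w \<times> B w)"
      proof (rule compactE_image[OF C, of C "\<lambda>w. A w \<times> B w"])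
        show "open (A w \<times> B w)" if "w \<in> C" for w using AB[OF that] by (simp add: open_Times)
        show "C \<subseteq> (\<Union>w\<in>C. A w \<times> B w)" using AB by blast
      qed auto
      define R where "R = (\<Union>w\<in>D. (K \<inter> A w) \<times> (L \<inter> B w))"
      have "(K \<inter> A w) \<times> (L \<inter> B w) \<in> sets ?P" if "w \<in> D" for w
      proof (rule pair_measureI)
        have "open (A w)" "open (B w)" using AB that D(1) by blast+
        then show "K \<inter> A w \<in> sets (restrict_space borel K)" "L \<inter> B w \<in> sets (restrict_space borel L)"
          unfolding sets_restrict_space by (auto intro: imageI)
      qed
      then have "R \<in> sets ?P" unfolding R_def using D(2) by (intro sets.finite_UN) auto
      moreover have "C \<subseteq> R"
      proof
        fix w assume w: "w \<in> C"
        then have "w \<in> K \<times> L" by (simp add: C_def)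
        then show "w \<in> R" using w D(3) unfolding R_def by fastforce
      qed
      moreover have "R \<subseteq> K \<times> L \<inter> T" unfolding R_def using AB D(1) by fast
      then have "R \<subseteq> {w \<in> K \<times> L. a - e < h w}" unfolding T(2)[symmetric] by auto
      ultimately show ?thesis by blast
    qed
    \<comment> \<open>Taking the tolerances 1/(n+1) exhibits \<open>C\<close> as a countable
      intersection of finite unions of measurable rectangles.\<close>
    then have "\<exists>R. R \<in> sets ?P \<and> C \<subseteq> R \<and> R \<subseteq> {w \<in> K \<times> L. a - 1 / Suc n < h w}" for n :: nat
      by simp
    then have "\<exists>R. \<forall>n::nat. R n \<in> sets ?P \<and> C \<subseteq> R n \<and> R n \<subseteq> {w \<in> K \<times> L. a - 1 / Suc n < h w}"
      by (intro choice allI)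
    then obtain R where R: "\<And>n. R n \<in> sets ?P" "\<And>n. C \<subseteq> R n"
      "\<And>n::nat. R n \<subseteq> {w \<in> K \<times> L. a - 1 / Suc n < h w}" by blast
    have "w \<in> C" if "\<And>n. w \<in> R n" for w
    proof -
      have *: "w \<in> K \<times> L" "a - 1 / Suc n < h w" for n using that R(3) by blast+
      have "(\<lambda>n. a - 1 / Suc n) \<longlonglongrightarrow> a - 0"
        by (intro tendsto_diff tendsto_const LIMSEQ_Suc lim_1_over_n)
      then have "a - 0 \<le> h w" using *(2) less_imp_le by (intro LIMSEQ_le_const2) blast+
      then show ?thesis using * by (simp add: C_def)
    qed
    then have "C = (\<Inter>n. R n)" using R(2) by blast
    moreover have "(\<Inter>n. R n) \<in> sets ?P" using R(1) by (intro sets.countable_INT) auto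
    ultimately show ?thesis by (simp add: C_def spP)
  qed
  then show ?thesis by (simp add: borel_measurable_iff_ge)
qed

section \<open>Haar measure and compactly supported functions\<close>

definition compactly_supported :: "('g::topological_space \<Rightarrow> real) \<Rightarrow> bool" where
  "compactly_supported f \<longleftrightarrow> continuous_on UNIV f \<and> (\<exists>K. compact K \<and> (\<forall>x. x \<notin> K \<longrightarrow> f x = 0))"

locale haar_group =
  fixes M :: "'g::{group_add, t2_space} measure" and \<Delta> :: "'g \<Rightarrow> real"
  assumes lc: "locally_compact_group TYPE('g)"
    and haar: "left_haar_measure M"
    and modular: "modular_function M \<Delta>"
begin

lemma sets_M [measurable_cong]: "sets M = sets borel"
  using haar by (simp add: left_haar_measure_def)

lemma space_M [simp]: "space M = UNIV"
  using sets_eq_imp_space_eq[OF sets_M] by simp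

lemma continuous_on_group_add [continuous_intros]:
  assumes "continuous_on S f" "continuous_on S g"
  shows "continuous_on S (\<lambda>x. f x + g x :: 'g)"
proof -
  have "continuous_on UNIV (\<lambda>p::'g \<times> 'g. fst p + snd p)"
    using lc by (simp add: locally_compact_group_def)
  from continuous_on_compose2[OF this continuous_on_Pair[OF assms]] show ?thesis by simp
qed

lemma continuous_on_group_minus [continuous_intros]:
  assumes "continuous_on S f"
  shows "continuous_on S (\<lambda>x. - f x :: 'g)"
proof -
  have "continuous_on UNIV (uminus :: 'g \<Rightarrow> 'g)"
    using lc by (simp add: locally_compact_group_def)
  from continuous_on_compose2[OF this assms] show ?thesis by simp
qed

lemma borel_measurable_continuous:
  fixes f :: "'g \<Rightarrow> 'b::topological_space"
  shows "continuous_on UNIV f \<Longrightarrow> f \<in> borel_measurable M"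
  using borel_measurable_continuous_onI measurable_cong_sets[OF sets_M refl] by blast

lemma compact_sets: "compact K \<Longrightarrow> K \<in> sets M"
  by (simp add: sets_M compact_imp_closed)

lemma compact_finite: "compact K \<Longrightarrow> emeasure M K < \<infinity>"
  using haar unfolding left_haar_measure_def by blast

lemma open_positive: "open V \<Longrightarrow> V \<noteq> {} \<Longrightarrow> emeasure M V > 0"
  using haar unfolding left_haar_measure_def by blast

lemma open_inner_regular:
  assumes "open V" "b < emeasure M V"
  obtains K where "compact K" "K \<subseteq> V" "b < emeasure M K"
proof -
  have "emeasure M V = (SUP K\<in>{K. compact K \<and> K \<subseteq> V}. emeasure M K)"
    using haar assms(1) unfolding left_haar_measure_def by blast
  then show thesis using assms(2) that by (auto simp: less_SUP_iff)
qed

lemma emeasure_left_translation: "A \<in> sets M \<Longrightarrow> emeasure M ((\<lambda>x. g + x) ` A) = emeasure M A"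
  using haar unfolding left_haar_measure_def by blast

lemma compact_nhd: obtains K where "compact K" "(x::'g) \<in> interior K"
  using lc by (auto simp: locally_compact_group_def)

lemma compact_diff: "compact K \<Longrightarrow> compact L \<Longrightarrow> compact ((\<lambda>(x::'g, y). x - y) ` (K \<times> L))"
  unfolding case_prod_beta diff_conv_add_uminus
  by (intro compact_continuous_image compact_Times continuous_intros)

lemma compact_uminus: "compact K \<Longrightarrow> compact (uminus ` (K :: 'g set))"
  by (intro compact_continuous_image continuous_intros)

lemma measurable_left_translation: "(\<lambda>x. g + x) \<in> measurable M M"
proof -
  have "(\<lambda>x. g + x) \<in> borel_measurable M"
    by (intro borel_measurable_continuous continuous_intros)
  then show ?thesis using measurable_cong_sets[OF refl sets_M] by blast
qed

lemma distr_left_translation: "distr M M (\<lambda>x. g + x) = M"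
proof (rule measure_eqI)
  fix A assume "A \<in> sets (distr M M ((+) g))"
  then have A: "A \<in> sets M" by simp
  \<comment> \<open>Invariance is assumed for images; the preimage under translation by
    \<open>g\<close> is the image under translation by \<open>- g\<close>.\<close>
  have "(+) g -` A \<inter> space M = (+) (- g) ` A"
  proof (intro set_eqI iffI)
    fix x assume "x \<in> (+) g -` A \<inter> space M"
    then have "g + x \<in> A" by simp
    then have "- g + (g + x) \<in> (+) (- g) ` A" by blast
    then show "x \<in> (+) (- g) ` A" by simp
  qed (auto simp flip: add.assoc)
  then show "emeasure (distr M M ((+) g)) A = emeasure M A"
    using A measurable_left_translation[of g]
    by (simp add: emeasure_distr emeasure_left_translation)
qed simp

lemma integral_left_translation:
  fixes f :: "'g \<Rightarrow> 'b::{banach, second_countable_topology}"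
  assumes "f \<in> borel_measurable M"
  shows "(\<integral>x. f (g + x) \<partial>M) = (\<integral>x. f x \<partial>M)"
  using integral_distr[OF measurable_left_translation assms, of g]
  by (simp add: distr_left_translation)

lemma compactly_supported_integrable:
  assumes "compactly_supported f"
  shows "integrable M f"
proof -
  obtain K where K: "compact K" "\<And>x. x \<notin> K \<Longrightarrow> f x = 0" and f: "continuous_on UNIV f"
    using assms by (auto simp: compactly_supported_def)
  have "compact (f ` K)" using K f continuous_on_subset by (metis compact_continuous_image top_greatest)
  then obtain B where "\<And>x. x \<in> K \<Longrightarrow> norm (f x) \<le> B"
    using compact_imp_bounded bounded_iff by (metis imageI)
  then show ?thesis
    using K f compact_finite by (intro integrableI_bounded_set[where A = K and B = B])
      (auto simp: compact_sets borel_measurable_continuous)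
qed

lemma compactly_supported_mult:
  assumes "compactly_supported f" "continuous_on UNIV g"
  shows "compactly_supported (\<lambda>x. f x * g x)" "compactly_supported (\<lambda>x. g x * f x)"
  using assms unfolding compactly_supported_def by (auto intro!: continuous_on_mult)

lemma compactly_supported_uminus:
  assumes "compactly_supported (f :: 'g \<Rightarrow> real)"
  shows "compactly_supported (\<lambda>x. f (- x))"
proof -
  obtain K where K: "compact K" "\<And>x. x \<notin> K \<Longrightarrow> f x = 0" and f: "continuous_on UNIV f"
    using assms by (auto simp: compactly_supported_def)
  have "f (- x) = 0" if "x \<notin> uminus ` K" for x
    using K(2) that by (metis imageI minus_minus)
  moreover have "continuous_on UNIV (\<lambda>x. f (- x))"
    by (intro continuous_on_compose2[OF f] continuous_intros) auto
  ultimately show ?thesis using compact_uminus[OF K(1)] unfolding compactly_supported_def by blast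
qed

lemma compactly_supported_right_translation:
  assumes "compactly_supported f"
  shows "compactly_supported (\<lambda>x. f (x + y :: 'g))"
proof -
  obtain K where K: "compact K" "\<And>x. x \<notin> K \<Longrightarrow> f x = 0" and f: "continuous_on UNIV f"
    using assms by (auto simp: compactly_supported_def)
  have "f (x + y) = 0" if "x \<notin> (\<lambda>z. z + - y) ` K" for x
    using K(2)[of "x + y"] that by (metis add_diff_cancel diff_conv_add_uminus imageI)
  moreover have "compact ((\<lambda>z. z + - y) ` K)"
    by (intro compact_continuous_image continuous_intros K)
  moreover have "continuous_on UNIV (\<lambda>x. f (x + y))"
    by (intro continuous_on_compose2[OF f] continuous_intros) auto
  ultimately show ?thesis unfolding compactly_supported_def by blast
qed

text \<open>Finitely many interiors of compact neighbourhoods cover \<open>K\<close>. Urysohn's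
  lemma, available since a locally compact Hausdorff space is completely regular, separates
  \<open>K\<close> from the complement of their union \<open>V\<close>, and \<open>V\<close> lies in
  a compact set.\<close>

lemma compactly_supported_cutoff:
  assumes "compact (K :: 'g set)"
  obtains u where "compactly_supported u" "\<And>x. 0 \<le> u x" "\<And>x. u x \<le> 1" "\<And>x. x \<in> K \<Longrightarrow> u x = 1"
proof -
  have "\<forall>x. \<exists>N. compact N \<and> (x::'g) \<in> interior N"
    using lc by (simp add: locally_compact_group_def)
  then obtain N where N: "\<And>x::'g. compact (N x) \<and> x \<in> interior (N x)" by metis
  obtain D where D: "D \<subseteq> K" "finite D" "K \<subseteq> (\<Union>x\<in>D. interior (N x))"
    by (rule compactE_image[OF assms, of K "\<lambda>x. interior (N x)"]) (use N in auto)
  define V where "V = (\<Union>x\<in>D. interior (N x))"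
  define L where "L = (\<Union>x\<in>D. N x)"
  have L: "compact L" unfolding L_def using N D by (intro compact_UN) auto
  have V: "open V" "V \<subseteq> L" unfolding V_def L_def using interior_subset by fastforce+
  have "locally_compact_space (euclidean :: 'g topology)"
    unfolding locally_compact_space_def
  proof
    fix x :: 'g
    show "\<exists>U K. openin euclidean U \<and> compactin euclidean K \<and> x \<in> U \<and> U \<subseteq> K"
      using N[of x] interior_subset[of "N x"]
      by (intro exI[of _ "interior (N x)"] exI[of _ "N x"]) auto
  qed
  moreover have "Hausdorff_space (euclidean :: 'g topology)"
    unfolding Hausdorff_space_def disjnt_def using hausdorff by auto
  ultimately have "completely_regular_space (euclidean :: 'g topology)"
    by (intro locally_compact_regular_imp_completely_regular_space disjI1)
  moreover have "disjnt K (- V)" using D by (auto simp: disjnt_def V_def)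
  moreover have "compactin euclidean K" "closedin euclidean (- V)"
    using assms V(1) by (auto simp: closed_Compl)
  ultimately obtain u where u: "continuous_map euclidean (top_of_set {0..1}) u"
    "u ` (- V) \<subseteq> {0::real}" "u ` K \<subseteq> {1}"
    using Urysohn_completely_regular_compact_closed[of 0 1 euclidean K "- V"] zero_le_one by blast
  have cont: "continuous_on UNIV u" and range: "range u \<subseteq> {0..1}"
    using u(1) by (auto simp: continuous_map_in_subtopology)
  show thesis
  proof
    have "u x = 0" if "x \<notin> L" for x using u(2) V(2) that by blast
    then show "compactly_supported u"
      using cont L by (auto simp: compactly_supported_def)
    show "0 \<le> u x" "u x \<le> 1" for x using range by (auto simp: image_subset_iff)
    show "u x = 1" if "x \<in> K" for x using u(3) that by blast
  qed
qed

text \<open>Supplies a test function whose integral can be divided out of identities. A cutoff equal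
  to 1 on a compact neighbourhood of the identity works, since nonempty open sets have positive
  measure.\<close>

lemma compactly_supported_positive_integral:
  obtains g where "compactly_supported g" "(\<integral>x. g x \<partial>M) > 0"
proof -
  obtain K where K: "compact K" "(0::'g) \<in> interior K" using compact_nhd by blast
  obtain u where u: "compactly_supported u" "\<And>x. 0 \<le> u x" "\<And>x. x \<in> K \<Longrightarrow> u x = 1"
    by (rule compactly_supported_cutoff[OF K(1)]) blast
  have "emeasure M (interior K) > 0"
    using K by (intro open_positive) auto
  also have "emeasure M (interior K) \<le> emeasure M K"
    using compact_sets[OF K(1)] by (intro emeasure_mono interior_subset)
  finally have "measure M K > 0"
    using compact_finite[OF K(1)] by (simp add: measure_def enn2real_positive_iff)
  also have "measure M K = (\<integral>x. indicator K x \<partial>M)" by simp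
  also have "\<dots> \<le> (\<integral>x. u x \<partial>M)"
    using compact_finite[OF K(1)] u
    by (intro integral_mono integrable_real_indicator compactly_supported_integrable)
       (auto simp: compact_sets K indicator_def)
  finally show thesis using that u(1) by blast
qed

text \<open>Restricted to \<open>K\<close> and \<open>L\<close> the measure is finite, so the usual
  Fubini theorem applies there; the integrand vanishes elsewhere, so nothing is lost.\<close>

lemma Fubini_compactly_supported:
  fixes h :: "'g \<times> 'g \<Rightarrow> real"
  assumes h: "continuous_on UNIV h" and K: "compact K" and L: "compact L"
    and zero: "\<And>x y. x \<notin> K \<or> y \<notin> L \<Longrightarrow> h (x, y) = 0"
  shows "(\<integral>x. (\<integral>y. h (x, y) \<partial>M) \<partial>M) = (\<integral>y. (\<integral>x. h (x, y) \<partial>M) \<partial>M)"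
proof -
  let ?A = "restrict_space M K" and ?B = "restrict_space M L"
  interpret A: finite_measure ?A
    using compact_finite[OF K] compact_sets[OF K]
    by (intro finite_measureI) (simp add: space_restrict_space emeasure_restrict_space)
  interpret B: finite_measure ?B
    using compact_finite[OF L] compact_sets[OF L]
    by (intro finite_measureI) (simp add: space_restrict_space emeasure_restrict_space)
  interpret pair_sigma_finite ?A ?B ..
  interpret AB: finite_measure "?A \<Otimes>\<^sub>M ?B"
    by (intro finite_measure_pair_measure) unfold_locales
  have hKL: "continuous_on (K \<times> L) h" using h continuous_on_subset by blast
  have "sets (?A \<Otimes>\<^sub>M ?B) = sets (restrict_space borel K \<Otimes>\<^sub>M restrict_space borel L)"
    by (intro sets_pair_measure_cong sets_restrict_space_cong sets_M)
  then have meas: "h \<in> borel_measurable (?A \<Otimes>\<^sub>M ?B)"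
    using borel_measurable_continuous_on_compact_rectangle[OF K L hKL] measurable_cong_sets by blast
  have "compact (h ` (K \<times> L))" using hKL K L compact_Times compact_continuous_image by blast
  then obtain C where C: "\<And>w. w \<in> K \<times> L \<Longrightarrow> norm (h w) \<le> C"
    using compact_imp_bounded bounded_iff by (metis imageI)
  have "integrable (?A \<Otimes>\<^sub>M ?B) h"
    using meas C by (intro AB.integrable_const_bound[where B = C])
      (auto simp: space_pair_measure space_restrict_space)
  then have int: "integrable (?A \<Otimes>\<^sub>M ?B) (\<lambda>(x, y). h (x, y))" by simp
  have r: "(\<integral>x. f x \<partial>?A) = (\<integral>x. f x \<partial>M)" if "\<And>x. x \<notin> K \<Longrightarrow> f x = 0" for f :: "'g \<Rightarrow> real"
    using that compact_sets[OF K] by (subst integral_restrict_space) (auto intro!: Bochner_Integration.integral_cong simp: indicator_def)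
  have s: "(\<integral>x. f x \<partial>?B) = (\<integral>x. f x \<partial>M)" if "\<And>x. x \<notin> L \<Longrightarrow> f x = 0" for f :: "'g \<Rightarrow> real"
    using that compact_sets[OF L] by (subst integral_restrict_space) (auto intro!: Bochner_Integration.integral_cong simp: indicator_def)
  have "(\<integral>y. (\<integral>x. h (x, y) \<partial>?A) \<partial>?B) = (\<integral>x. (\<integral>y. h (x, y) \<partial>?B) \<partial>?A)"
    by (rule Fubini_integral[OF int])
  then show ?thesis by (simp add: r s zero)
qed

section \<open>The modular function\<close>

lemma modular_pos: "\<Delta> y > 0"
  using modular by (simp add: modular_function_def)

lemma integral_right_translation:
  "integrable M f \<Longrightarrow> (\<integral>x. f (x + y) \<partial>M) = \<Delta> (- y) * (\<integral>x. f x \<partial>M)" for f :: "'g \<Rightarrow> real"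
  using modular by (simp add: modular_function_def)

text \<open>Translating a test function by \<open>y\<close> and back multiplies its nonzero integral
  by \<open>\<Delta> y * \<Delta> (- y)\<close>.\<close>

lemma modular_inverse: "\<Delta> (- y) = inverse (\<Delta> y)"
proof -
  obtain g where g: "compactly_supported g" "(\<integral>x. g x \<partial>M) > 0"
    using compactly_supported_positive_integral by blast
  have "(\<integral>x. g x \<partial>M) = (\<integral>x. g ((x + - y) + y) \<partial>M)" by simp
  also have "\<dots> = \<Delta> (- (- y)) * (\<integral>x. g (x + y) \<partial>M)"
    by (rule integral_right_translation)
       (intro compactly_supported_integrable compactly_supported_right_translation g)
  also have "\<dots> = \<Delta> y * (\<Delta> (- y) * (\<integral>x. g x \<partial>M))"
    using g by (simp add: integral_right_translation compactly_supported_integrable)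
  finally have "\<Delta> y * \<Delta> (- y) = 1" using g(2) by simp
  then show ?thesis by (metis inverse_unique)
qed

text \<open>For \<open>y\<close> in a compact neighbourhood of \<open>y0\<close> all translates
  vanish off one compact set \<open>L\<close>. On \<open>L\<close> they converge uniformly as
  \<open>y\<close> tends to \<open>y0\<close>, and \<open>L\<close> has finite measure.\<close>

lemma continuous_on_integral_right_translation:
  assumes "compactly_supported g"
  shows "continuous_on UNIV (\<lambda>y. \<integral>x. g (x + y) \<partial>M)"
  unfolding continuous_on_eq_continuous_at[OF open_UNIV] continuous_at
proof (intro ballI tendstoI)
  fix y0 :: 'g and e :: real assume e: "e > 0"
  obtain K where K: "compact K" "\<And>x. x \<notin> K \<Longrightarrow> g x = 0" and g: "continuous_on UNIV g"
    using assms by (auto simp: compactly_supported_def)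
  obtain W where W: "compact W" "y0 \<in> interior W" using compact_nhd by blast
  define L where "L = (\<lambda>(x::'g, y). x - y) ` (K \<times> W)"
  have L: "compact L" unfolding L_def by (rule compact_diff[OF K(1) W(1)])
  \<comment> \<open>The summand 1 covers the case that \<open>L\<close> is a null set.\<close>
  define d where "d = e / (measure M L + 1)"
  have d: "d > 0" "d * measure M L < e"
  proof -
    have m: "measure M L + 1 > 0" by (simp add: add_nonneg_pos)
    then show "d > 0" using e by (simp add: d_def)
    then show "d * measure M L < e" using m e by (simp add: d_def pos_divide_less_eq)
  qed
  have "continuous_on (interior W \<times> L) (\<lambda>(y, x). g (x + y))"
    unfolding case_prod_beta by (intro continuous_on_compose2[OF g] continuous_intros) auto
  from continuous_on_prod_compactE[OF this L W(2) d(1)]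
  obtain X where X: "y0 \<in> X" "open X"
    and bound: "\<And>y x. y \<in> X \<inter> interior W \<Longrightarrow> x \<in> L \<Longrightarrow> dist (g (x + y)) (g (x + y0)) \<le> d"
    by (metis (mono_tags, lifting) case_prod_conv)
  have "dist (\<integral>x. g (x + y) \<partial>M) (\<integral>x. g (x + y0) \<partial>M) < e" if y: "y \<in> X \<inter> interior W" for y
  proof -
    have int: "integrable M (\<lambda>x. g (x + z))" for z
      by (intro compactly_supported_integrable compactly_supported_right_translation assms)
    have out: "g (x + z) = 0" if "x \<notin> L" "z \<in> interior W" for x z
    proof (rule ccontr)
      assume "g (x + z) \<noteq> 0"
      then have "x + z \<in> K" using K(2) by blast
      moreover have "z \<in> W" using that interior_subset by blast
      ultimately have "(x + z) - z \<in> L" unfolding L_def by force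
      then show False using that by simp
    qed
    have "dist (\<integral>x. g (x + y) \<partial>M) (\<integral>x. g (x + y0) \<partial>M) = norm (\<integral>x. g (x + y) - g (x + y0) \<partial>M)"
      using int by (simp add: dist_norm)
    also have "\<dots> \<le> (\<integral>x. norm (g (x + y) - g (x + y0)) \<partial>M)" by (rule integral_norm_bound)
    also have "\<dots> \<le> (\<integral>x. d * indicator L x \<partial>M)"
    proof (rule integral_mono)
      show "integrable M (\<lambda>x. d * indicator L x)"
        using compact_finite[OF L] compact_sets[OF L] by (simp add: integrable_real_indicator)
      show "norm (g (x + y) - g (x + y0)) \<le> d * indicator L x" for x
        using bound[OF y, of x] out[of x y] out[of x y0] y W(2)
        by (cases "x \<in> L") (auto simp: dist_norm)
    qed (use int in auto)
    also have "\<dots> = d * measure M L" by simp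
    finally show ?thesis using d(2) by simp
  qed
  then show "\<forall>\<^sub>F y in at y0. dist (\<integral>x. g (x + y) \<partial>M) (\<integral>x. g (x + y0) \<partial>M) < e"
    unfolding eventually_at_topological
    using X W(2) by (intro exI[of _ "X \<inter> interior W"]) auto
qed

text \<open>\<open>\<Delta>\<close> is specified only through integrals, so its continuity is read
  off from the translates of one test function with nonzero integral.\<close>

lemma continuous_on_modular: "continuous_on UNIV \<Delta>"
proof -
  obtain g where g: "compactly_supported g" "(\<integral>x. g x \<partial>M) > 0"
    using compactly_supported_positive_integral by blast
  have "\<Delta> y = (\<integral>x. g (x + - y) \<partial>M) / (\<integral>x. g x \<partial>M)" for y
    using integral_right_translation[OF compactly_supported_integrable[OF g(1)], of "- y"] g(2) by simp
  moreover have "continuous_on UNIV (\<lambda>y. (\<integral>x. g (x + - y) \<partial>M) / (\<integral>x. g x \<partial>M))"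
    using g(2)
    by (intro continuous_intros continuous_on_compose2[OF continuous_on_integral_right_translation[OF g(1)]]) auto
  ultimately show ?thesis by presburger
qed

lemma continuous_on_modular_uminus: "continuous_on UNIV (\<lambda>x. \<Delta> (- x))"
  by (intro continuous_on_compose2[OF continuous_on_modular] continuous_intros) auto

text \<open>Both sides, multiplied by \<open>\<integral> g\<close>, are equal to \<open>\<integral>\<integral> f(x) g(yx) dx dy\<close>.\<close>

lemma integral_inversion_compactly_supported:
  assumes f: "compactly_supported f"
  shows "(\<integral>x. f x * \<Delta> (- x) \<partial>M) = (\<integral>x. f (- x) \<partial>M)"
proof -
  obtain g where g: "compactly_supported g" "(\<integral>x. g x \<partial>M) > 0"
    using compactly_supported_positive_integral by blast
  obtain K where K: "compact K" "\<And>x. x \<notin> K \<Longrightarrow> f x = 0" and fc: "continuous_on UNIV f"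
    using f by (auto simp: compactly_supported_def)
  obtain L where L: "compact L" "\<And>x. x \<notin> L \<Longrightarrow> g x = 0" and gc: "continuous_on UNIV g"
    using g by (auto simp: compactly_supported_def)
  \<comment> \<open>One compact set serves both exchanges of integrals: \<open>y\<close> is a point
    of \<open>L\<close> minus a point of \<open>K\<close> whenever either double integrand is
    nonzero.\<close>
  define N where "N = (\<lambda>(x::'g, y). x - y) ` (L \<times> K)"
  have N: "compact N" unfolding N_def by (rule compact_diff[OF L(1) K(1)])
  have "(\<integral>x. f x * \<Delta> (- x) \<partial>M) * (\<integral>x. g x \<partial>M) = (\<integral>x. f x * (\<Delta> (- x) * (\<integral>y. g y \<partial>M)) \<partial>M)"
    by (simp flip: mult.assoc)
  also have "\<dots> = (\<integral>x. (\<integral>y. f x * g (y + x) \<partial>M) \<partial>M)"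
    using integral_right_translation[OF compactly_supported_integrable[OF g(1)]] by simp
  also have "\<dots> = (\<integral>y. (\<integral>x. f x * g (y + x) \<partial>M) \<partial>M)"
  proof -
    have "continuous_on UNIV (\<lambda>(x, y). f x * g (y + x))"
      unfolding case_prod_beta
      by (intro continuous_on_mult continuous_on_compose2[OF fc] continuous_on_compose2[OF gc] continuous_intros) auto
    moreover have "f x * g (y + x) = 0" if "x \<notin> K \<or> y \<notin> N" for x y
    proof (rule ccontr)
      assume "f x * g (y + x) \<noteq> 0"
      then have *: "x \<in> K" "y + x \<in> L" using K(2) L(2) by auto
      then have "(y + x) - x \<in> N" unfolding N_def by force
      then show False using * that by simp
    qed
    ultimately show ?thesis
      using Fubini_compactly_supported[of "\<lambda>(x, y). f x * g (y + x)", OF _ K(1) N] by simp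
  qed
  \<comment> \<open>Left invariance in the inner variable moves the translation from
    \<open>g\<close> to \<open>f\<close>, so that after the next exchange the \<open>y\<close>
    integral no longer depends on \<open>x\<close>.\<close>
  also have "\<dots> = (\<integral>y. (\<integral>x. f (- y + x) * g x \<partial>M) \<partial>M)"
  proof (rule Bochner_Integration.integral_cong[OF refl])
    fix y
    have "(\<lambda>x. f x * g (y + x)) \<in> borel_measurable M"
      by (intro borel_measurable_continuous continuous_on_mult fc continuous_on_compose2[OF gc] continuous_intros) auto
    from integral_left_translation[OF this, of "- y"]
    show "(\<integral>x. f x * g (y + x) \<partial>M) = (\<integral>x. f (- y + x) * g x \<partial>M)"
      by (simp flip: add.assoc)
  qed
  also have "\<dots> = (\<integral>x. (\<integral>y. f (- y + x) * g x \<partial>M) \<partial>M)"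
  proof -
    have "continuous_on UNIV (\<lambda>(x, y). f (- y + x) * g x)"
      unfolding case_prod_beta
      by (intro continuous_on_mult continuous_on_compose2[OF fc] continuous_on_compose2[OF gc] continuous_intros) auto
    moreover have "f (- y + x) * g x = 0" if "x \<notin> L \<or> y \<notin> N" for x y
    proof (rule ccontr)
      assume "f (- y + x) * g x \<noteq> 0"
      then have *: "x \<in> L" "- y + x \<in> K" using K(2) L(2) by auto
      then have "x - (- y + x) \<in> N" unfolding N_def by force
      then show False using * that by (simp add: diff_add_eq_diff_diff_swap)
    qed
    ultimately show ?thesis
      using Fubini_compactly_supported[of "\<lambda>(x, y). f (- y + x) * g x", OF _ L(1) N] by simp
  qed
  also have "\<dots> = (\<integral>x. (\<integral>y. f (- y) \<partial>M) * g x \<partial>M)"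
  proof (rule Bochner_Integration.integral_cong[OF refl])
    fix x
    have "(\<lambda>y. f (- y + x)) \<in> borel_measurable M"
      by (intro borel_measurable_continuous continuous_on_compose2[OF fc] continuous_intros) auto
    from integral_left_translation[OF this, of x]
    have "(\<integral>y. f (- y + x) \<partial>M) = (\<integral>y. f (- y) \<partial>M)"
      by (simp add: minus_add add.assoc)
    then show "(\<integral>y. f (- y + x) * g x \<partial>M) = (\<integral>y. f (- y) \<partial>M) * g x" by simp
  qed
  also have "\<dots> = (\<integral>x. f (- x) \<partial>M) * (\<integral>x. g x \<partial>M)" by simp
  finally show ?thesis using g(2) by simp
qed

section \<open>Inversion of continuous functions\<close>

text \<open>Haar measure need not be \<open>\<sigma>\<close>-finite, so integrals of continuous functions are exhausted by compact
  sets only through the inner regularity of the open sets \<open>{P > t}\<close>.\<close>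

lemma nn_integral_inner_regular:
  fixes P :: "'g \<Rightarrow> real"
  assumes P: "continuous_on UNIV P" and pos: "\<And>x. 0 \<le> P x" and c: "c < (\<integral>\<^sup>+x. P x \<partial>M)"
  obtains K where "compact K" "c < (\<integral>\<^sup>+x. P x * indicator K x \<partial>M)"
proof -
  have [measurable]: "P \<in> borel_measurable M" using P by (rule borel_measurable_continuous)
  define V where "V n = {x. 1 / Suc n < P x}" for n :: nat
  \<comment> \<open>Cutting off both small values, through \<open>V n\<close>, and large values,
    through the height \<open>n\<close>, reduces the claim to inner regularity of the measure of one
    open set.\<close>
  define f where "f n x = ennreal (min (P x) (real n) * indicator (V n) x)" for n x
  have V: "open (V n)" for n
    unfolding V_def using P by (intro open_Collect_less continuous_intros)
  have Vm [measurable]: "V n \<in> sets M" for n using V by (simp add: sets_M)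
  have [measurable]: "f n \<in> borel_measurable M" for n unfolding f_def by measurable
  have "incseq f"
  proof (intro incseq_SucI le_funI)
    fix n x
    have "V n \<subseteq> V (Suc n)"
    proof
      fix z assume "z \<in> V n"
      moreover have "1 / real (Suc (Suc n)) \<le> 1 / real (Suc n)" by (simp add: frac_le)
      ultimately show "z \<in> V (Suc n)" unfolding V_def by simp
    qed
    then show "f n x \<le> f (Suc n) x"
      unfolding f_def using pos[of x] by (intro ennreal_leI mult_mono) (auto simp: indicator_def)
  qed
  moreover have "(SUP n. f n x) = P x" for x
  proof (rule antisym)
    show "(SUP n. f n x) \<le> P x"
      using pos[of x] by (intro SUP_least) (auto simp: f_def indicator_def intro!: ennreal_leI)
    show "P x \<le> (SUP n. f n x)"
    proof (cases "P x = 0")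
      case False
      then obtain n1 :: nat where n1: "1 / Suc n1 < P x"
        using pos[of x] by (metis less_eq_real_def nat_approx_posE)
      obtain n2 :: nat where n2: "P x \<le> n2" using real_arch_simple by blast
      let ?n = "max n1 n2"
      have "1 / Suc ?n \<le> 1 / Suc n1" by (simp add: frac_le)
      then have "x \<in> V ?n" using n1 unfolding V_def by simp
      then have "f ?n x = P x" using n2 by (simp add: f_def min_absorb1)
      then show ?thesis by (metis SUP_upper UNIV_I)
    qed simp
  qed
  ultimately have "(\<integral>\<^sup>+x. P x \<partial>M) = (SUP n. \<integral>\<^sup>+x. f n x \<partial>M)"
    using nn_integral_monotone_convergence_SUP[of f M] by simp
  then obtain n where n: "c < (\<integral>\<^sup>+x. f n x \<partial>M)" using c less_SUP_iff by metis
  then have c_fin: "c < \<infinity>" using less_le_trans[of c _ \<infinity>] by simp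
  have inner: "\<exists>K. compact K \<and> K \<subseteq> V n \<and> b < emeasure M K" if "b < emeasure M (V n)" for b
    by (rule open_inner_regular[OF V[of n] that]) blast
  have mono: "(\<integral>\<^sup>+x. f n x * indicator K x \<partial>M) \<le> (\<integral>\<^sup>+x. P x * indicator K x \<partial>M)" for K
    using pos by (intro nn_integral_mono) (auto simp: f_def indicator_def intro!: ennreal_leI)
  show thesis
  proof (cases "emeasure M (V n) = \<infinity>")
    case True
    \<comment> \<open>Since \<open>P\<close> exceeds 1/(n+1) on \<open>V n\<close>, a compact subset
      of measure above c(n+1) already contributes more than \<open>c\<close>.\<close>
    have "c * ennreal (Suc n) < emeasure M (V n)"
      using True c_fin by (simp add: ennreal_mult_less_top)
    then obtain K where K: "compact K" "K \<subseteq> V n" "c * ennreal (Suc n) < emeasure M K"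
      using inner by blast
    have "ennreal (Suc n) * ennreal (1 / Suc n) = 1"
      by (subst ennreal_mult[symmetric]) auto
    then have "c = (c * ennreal (Suc n)) * ennreal (1 / Suc n)"
      by (simp only: mult.assoc mult_1_right)
    also have "\<dots> < emeasure M K * ennreal (1 / Suc n)"
      using K(3) by (intro ennreal_mult_strict_right_mono) auto
    also have "\<dots> = (\<integral>\<^sup>+x. ennreal (1 / Suc n) * indicator K x \<partial>M)"
      using compact_sets[OF K(1)] by (subst nn_integral_cmult_indicator) (auto simp: mult.commute)
    also have "\<dots> \<le> (\<integral>\<^sup>+x. P x * indicator K x \<partial>M)"
      using K(2) by (intro nn_integral_mono) (auto simp: V_def indicator_def intro!: ennreal_leI)
    finally show thesis using that K(1) by blast
  next
    case False
    have f_le: "f n x \<le> ennreal n * indicator (V n) x" for x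
      using pos[of x] by (auto simp: f_def indicator_def intro!: ennreal_leI)
    have "(\<integral>\<^sup>+x. f n x \<partial>M) \<le> (\<integral>\<^sup>+x. ennreal n * indicator (V n) x \<partial>M)"
      by (intro nn_integral_mono f_le)
    also have "\<dots> = ennreal n * emeasure M (V n)" by (simp add: nn_integral_cmult_indicator)
    finally have I_le: "(\<integral>\<^sup>+x. f n x \<partial>M) \<le> ennreal n * emeasure M (V n)" .
    have I_fin: "(\<integral>\<^sup>+x. f n x \<partial>M) < \<infinity>"
      by (rule le_less_trans[OF I_le]) (use False in \<open>simp add: ennreal_mult_less_top less_top\<close>)
    have I_pos: "0 < (\<integral>\<^sup>+x. f n x \<partial>M)" using n by (rule le_less_trans[rotated]) simp
    have "0 < ennreal n * emeasure M (V n)" using I_pos I_le by (rule less_le_trans)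
    then have V_pos: "0 < emeasure M (V n)" and n_pos: "0 < n"
      by (simp_all add: ennreal_zero_less_mult_iff)
    obtain i where i: "(\<integral>\<^sup>+x. f n x \<partial>M) = ennreal i" "i \<ge> 0"
      using I_fin by (cases "\<integral>\<^sup>+x. f n x \<partial>M") auto
    obtain c' where c': "c = ennreal c'" "c' \<ge> 0" using c_fin by (cases c) auto
    obtain m where m: "emeasure M (V n) = ennreal m" "m \<ge> 0"
      using False by (cases "emeasure M (V n)") auto
    have "c' < i" using n i c' by (simp add: ennreal_less_iff)
    \<comment> \<open>Dropping a set of measure at most \<open>d\<close> costs at most
      \<open>n * d\<close>, half of the gap between \<open>c'\<close> and \<open>i\<close>.\<close>
    define d where "d = (i - c') / (2 * n)"
    have d: "d > 0" "c' + n * d < i"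
      using \<open>c' < i\<close> n_pos by (auto simp: d_def field_simps)
    have "ennreal (m - d) < emeasure M (V n)"
      using m d(1) V_pos by (simp add: ennreal_lessI)
    then obtain K where K: "compact K" "K \<subseteq> V n" "ennreal (m - d) < emeasure M K"
      using inner by blast
    have Km [measurable]: "K \<in> sets M" using compact_sets[OF K(1)] .
    obtain k where k: "emeasure M K = ennreal k" "k \<ge> 0"
      using compact_finite[OF K(1)] by (cases "emeasure M K") auto
    have "m - d < k" using K(3) k by (metis ennreal_leI not_le)
    have "emeasure M (V n - K) = emeasure M (V n) - emeasure M K"
      using compact_finite[OF K(1)] K(2) by (intro emeasure_Diff) auto
    also have "\<dots> = ennreal (m - k)" using m k by (simp add: ennreal_minus)
    also have "\<dots> \<le> ennreal d" using \<open>m - d < k\<close> by (intro ennreal_leI) simp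
    finally have VK: "emeasure M (V n - K) \<le> ennreal d" .
    have "c < (\<integral>\<^sup>+x. P x * indicator K x \<partial>M)"
    proof (rule ccontr)
      assume "\<not> ?thesis"
      then have le: "(\<integral>\<^sup>+x. P x * indicator K x \<partial>M) \<le> c" by simp
      have "(\<integral>\<^sup>+x. f n x \<partial>M) \<le> (\<integral>\<^sup>+x. f n x * indicator K x + ennreal n * indicator (V n - K) x \<partial>M)"
      proof (rule nn_integral_mono)
        fix x
        show "f n x \<le> f n x * indicator K x + ennreal n * indicator (V n - K) x"
          using f_le[of x] by (cases "x \<in> K"; cases "x \<in> V n") auto
      qed
      also have "\<dots> = (\<integral>\<^sup>+x. f n x * indicator K x \<partial>M) + ennreal n * emeasure M (V n - K)"
        by (simp add: nn_integral_add nn_integral_cmult_indicator)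
      also have "\<dots> \<le> c + ennreal n * ennreal d"
        using mono[of K] le VK by (intro add_mono mult_left_mono) auto
      also have "\<dots> = ennreal (c' + n * d)"
        using c' d(1) by (simp add: ennreal_mult ennreal_plus)
      also have "\<dots> < ennreal i" using d(2) c'(2) \<open>c' < i\<close> by (intro ennreal_lessI) auto
      finally show False by (simp add: i)
    qed
    then show thesis using that K(1) by blast
  qed
qed

text \<open>A compact set captures any smaller value of the left integral. Multiplying
  \<open>F\<close> by a cutoff that is 1 on this set brings in the compactly supported formula;
  dropping the cutoff on the right leaves only an inequality.\<close>

lemma nn_integral_inversion_le:
  fixes F :: "'g \<Rightarrow> real"
  assumes F: "continuous_on UNIV F" and pos: "\<And>x. 0 \<le> F x"
  shows "(\<integral>\<^sup>+x. F x * \<Delta> (- x) \<partial>M) \<le> (\<integral>\<^sup>+x. F (- x) \<partial>M)"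
proof (rule dense_le)
  fix c assume c: "c < (\<integral>\<^sup>+x. F x * \<Delta> (- x) \<partial>M)"
  have cont: "continuous_on UNIV (\<lambda>x. F x * \<Delta> (- x))"
    by (intro continuous_on_mult F continuous_on_modular_uminus)
  have nonneg: "0 \<le> F x * \<Delta> (- x)" for x
    using pos modular_pos less_imp_le by (intro mult_nonneg_nonneg) blast+
  obtain K where K: "compact K"
      "c < (\<integral>\<^sup>+x. ennreal (F x * \<Delta> (- x) * indicator K x) \<partial>M)"
    by (rule nn_integral_inner_regular[OF cont nonneg c])
  obtain u where u: "compactly_supported u" "\<And>x. 0 \<le> u x" "\<And>x. u x \<le> 1" "\<And>x. x \<in> K \<Longrightarrow> u x = 1"
    by (rule compactly_supported_cutoff[OF K(1)]) blast
  have Fu: "compactly_supported (\<lambda>x. F x * u x)" using compactly_supported_mult[OF u(1) F] by simp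
  have "c \<le> (\<integral>\<^sup>+x. ennreal (F x * \<Delta> (- x) * indicator K x) \<partial>M)" using K(2) by simp
  also have "\<dots> \<le> (\<integral>\<^sup>+x. (F x * u x) * \<Delta> (- x) \<partial>M)"
    using u by (intro nn_integral_mono) (auto simp: indicator_def)
  also have "\<dots> = ennreal (\<integral>x. (F x * u x) * \<Delta> (- x) \<partial>M)"
    using u(2) pos less_imp_le[OF modular_pos]
    by (intro nn_integral_eq_integral compactly_supported_integrable
        compactly_supported_mult(1)[OF Fu continuous_on_modular_uminus]) auto
  also have "\<dots> = ennreal (\<integral>x. F (- x) * u (- x) \<partial>M)"
    using integral_inversion_compactly_supported[OF Fu] by simp
  also have "\<dots> = (\<integral>\<^sup>+x. F (- x) * u (- x) \<partial>M)"
    using u(2) pos compactly_supported_integrable[OF compactly_supported_uminus[OF Fu]]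
    by (intro nn_integral_eq_integral[symmetric]) auto
  also have "\<dots> \<le> (\<integral>\<^sup>+x. F (- x) \<partial>M)"
    using u pos by (intro nn_integral_mono ennreal_leI) (simp add: mult_left_le)
  finally show "c \<le> (\<integral>\<^sup>+x. F (- x) \<partial>M)" .
qed

text \<open>The reverse inequality is the same one for \<open>F (- x) * \<Delta> x\<close>, as the
  modular factors then cancel.\<close>

lemma nn_integral_inversion:
  fixes F :: "'g \<Rightarrow> real"
  assumes F: "continuous_on UNIV F" and pos: "\<And>x. 0 \<le> F x"
  shows "(\<integral>\<^sup>+x. F x * \<Delta> (- x) \<partial>M) = (\<integral>\<^sup>+x. F (- x) \<partial>M)"
proof (rule antisym)
  have "continuous_on UNIV (\<lambda>x. F (- x) * \<Delta> x)"
    by (intro continuous_on_mult continuous_on_modular continuous_on_compose2[OF F] continuous_intros) auto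
  moreover have "0 \<le> F (- x) * \<Delta> x" for x
    using pos modular_pos less_imp_le by (intro mult_nonneg_nonneg) blast+
  ultimately have "(\<integral>\<^sup>+x. F (- x) * \<Delta> x * \<Delta> (- x) \<partial>M) \<le> (\<integral>\<^sup>+x. F (- (- x)) * \<Delta> (- x) \<partial>M)"
    by (rule nn_integral_inversion_le)
  then have "(\<integral>\<^sup>+x. F (- x) * \<Delta> x * \<Delta> (- x) \<partial>M) \<le> (\<integral>\<^sup>+x. F x * \<Delta> (- x) \<partial>M)"
    by simp
  moreover have "F (- x) * \<Delta> x * \<Delta> (- x) = F (- x)" for x
    using modular_pos[of x] by (simp add: modular_inverse)
  ultimately show "(\<integral>\<^sup>+x. F (- x) \<partial>M) \<le> (\<integral>\<^sup>+x. F x * \<Delta> (- x) \<partial>M)" by simp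
qed (rule nn_integral_inversion_le[OF assms])

text \<open>Positive and negative parts of a continuous function are continuous, so the nonnegative
  case applies to each. Integrability of the weighted function is part of the conclusion and later
  yields square integrability.\<close>

lemma has_bochner_integral_inversion_real:
  fixes F :: "'g \<Rightarrow> real"
  assumes F: "continuous_on UNIV F" and int: "integrable M (\<lambda>x. F (- x))"
  shows "has_bochner_integral M (\<lambda>x. F x * \<Delta> (- x)) (\<integral>x. F (- x) \<partial>M)"
proof -
  have nonneg: "has_bochner_integral M (\<lambda>x. G x * \<Delta> (- x)) (\<integral>x. G (- x) \<partial>M)"
    if G: "continuous_on UNIV G" "\<And>x. 0 \<le> G x" "integrable M (\<lambda>x. G (- x))" for G
  proof (rule has_bochner_integral_nn_integral)
    show "(\<lambda>x. G x * \<Delta> (- x)) \<in> borel_measurable M"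
      by (intro borel_measurable_continuous continuous_on_mult continuous_on_modular_uminus G)
    show "(\<integral>\<^sup>+x. G x * \<Delta> (- x) \<partial>M) = ennreal (\<integral>x. G (- x) \<partial>M)"
      using nn_integral_inversion[OF G(1,2)] nn_integral_eq_integral[OF G(3)] G(2) by simp
    show "AE x in M. 0 \<le> G x * \<Delta> (- x)"
      using G(2) less_imp_le[OF modular_pos] by simp
    show "0 \<le> (\<integral>x. G (- x) \<partial>M)" using G(2) by simp
  qed
  let ?p = "\<lambda>x. max (F x) 0" and ?n = "\<lambda>x. max (- F x) 0"
  have ip: "integrable M (\<lambda>x. ?p (- x))" and im: "integrable M (\<lambda>x. ?n (- x))"
    using int by auto
  have "has_bochner_integral M (\<lambda>x. ?p x * \<Delta> (- x) - ?n x * \<Delta> (- x))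
      ((\<integral>x. ?p (- x) \<partial>M) - (\<integral>x. ?n (- x) \<partial>M))"
    using F ip im by (intro has_bochner_integral_diff nonneg continuous_intros) auto
  moreover have "?p x * \<Delta> (- x) - ?n x * \<Delta> (- x) = F x * \<Delta> (- x)" for x
    by (simp add: max_def flip: left_diff_distrib)
  moreover have "(\<integral>x. ?p (- x) \<partial>M) - (\<integral>x. ?n (- x) \<partial>M) = (\<integral>x. F (- x) \<partial>M)"
    unfolding Bochner_Integration.integral_diff[OF ip im, symmetric]
    by (rule Bochner_Integration.integral_cong) auto
  ultimately show ?thesis by simp
qed

lemma has_bochner_integral_inversion:
  fixes F :: "'g \<Rightarrow> complex"
  assumes F: "continuous_on UNIV F" and int: "integrable M (\<lambda>x. F (- x))"
  shows "has_bochner_integral M (\<lambda>x. F x * complex_of_real (\<Delta> (- x))) (\<integral>x. F (- x) \<partial>M)"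
proof -
  have "has_bochner_integral M (\<lambda>x. Re (F x) * \<Delta> (- x)) (\<integral>x. Re (F (- x)) \<partial>M)"
    "has_bochner_integral M (\<lambda>x. Im (F x) * \<Delta> (- x)) (\<integral>x. Im (F (- x)) \<partial>M)"
    using F int by (intro has_bochner_integral_inversion_real continuous_intros; simp)+
  then have "has_bochner_integral M
      (\<lambda>x. complex_of_real (Re (F x) * \<Delta> (- x)) + \<i> * complex_of_real (Im (F x) * \<Delta> (- x)))
      (complex_of_real (\<integral>x. Re (F (- x)) \<partial>M) + \<i> * complex_of_real (\<integral>x. Im (F (- x)) \<partial>M))"
    by (intro has_bochner_integral_add has_bochner_integral_mult_right
        has_bochner_integral_bounded_linear[OF bounded_linear_of_real])
  moreover have "complex_of_real (Re (F x) * \<Delta> (- x)) + \<i> * complex_of_real (Im (F x) * \<Delta> (- x))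
      = F x * complex_of_real (\<Delta> (- x))" for x
    by (simp add: complex_eq_iff)
  moreover have "complex_of_real (\<integral>x. Re (F (- x)) \<partial>M) + \<i> * complex_of_real (\<integral>x. Im (F (- x)) \<partial>M)
      = (\<integral>x. F (- x) \<partial>M)"
    using int by (simp add: complex_eq_iff)
  ultimately show ?thesis by simp
qed

end

subsection \<open>Matrix coefficients\<close>

lemma square_integrable_integrable_inner:
  assumes f: "square_integrable M f" and g: "square_integrable M g"
  shows "integrable M (\<lambda>x. cnj (f x) * g x)"
proof (rule Bochner_Integration.integrable_bound)
  show "integrable M (\<lambda>x. (cmod (f x))\<^sup>2 + (cmod (g x))\<^sup>2)"
    using f g by (simp add: square_integrable_def)
  have [measurable]: "f \<in> borel_measurable M" "g \<in> borel_measurable M"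
    using f g by (simp_all add: square_integrable_def)
  have [measurable]: "(\<lambda>x. cnj (f x)) \<in> borel_measurable M"
    using borel_measurable_continuous_onI[OF continuous_on_cnj[OF continuous_on_id]]
    by (rule measurable_compose[rotated]) measurable
  show "(\<lambda>x. cnj (f x) * g x) \<in> borel_measurable M" by measurable
  have "a * b \<le> a\<^sup>2 + b\<^sup>2" if "0 \<le> a" "0 \<le> b" for a b :: real
    using sum_squares_bound[of a b] mult_nonneg_nonneg[OF that] by simp
  then show "AE x in M. norm (cnj (f x) * g x) \<le> norm ((cmod (f x))\<^sup>2 + (cmod (g x))\<^sup>2)"
    by (simp add: norm_mult)
qed

lemma L2_inner_Cauchy_Schwarz:
  assumes f: "square_integrable M f" and g: "square_integrable M g"
  shows "cmod (L2_inner M f g) \<le> sqrt (L2_norm_sq M f) * sqrt (L2_norm_sq M g)"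
proof -
  have [measurable]: "f \<in> borel_measurable M" "g \<in> borel_measurable M"
    using f g by (simp_all add: square_integrable_def)
  have int: "integrable M (\<lambda>x. cmod (f x) * cmod (g x))"
    using integrable_norm[OF square_integrable_integrable_inner[OF f g]] by (simp add: norm_mult)
  have nn: "(\<integral>\<^sup>+x. (ennreal (cmod (h x)))\<^sup>2 \<partial>M) = ennreal (L2_norm_sq M h)"
    if "square_integrable M h" for h
    using that unfolding L2_norm_sq_def square_integrable_def
    by (subst nn_integral_eq_integral[symmetric]) (auto simp: ennreal_power)
  let ?I = "\<integral>x. cmod (f x) * cmod (g x) \<partial>M"
  have "(ennreal ?I)\<^sup>2 = (\<integral>\<^sup>+x. ennreal (cmod (f x)) * ennreal (cmod (g x)) \<partial>M)\<^sup>2"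
    using int by (subst nn_integral_eq_integral[symmetric]) (auto simp: ennreal_mult)
  also have "\<dots> \<le> (\<integral>\<^sup>+x. (ennreal (cmod (f x)))\<^sup>2 \<partial>M) * (\<integral>\<^sup>+x. (ennreal (cmod (g x)))\<^sup>2 \<partial>M)"
    by (rule Cauchy_Schwarz_nn_integral) measurable
  also have "\<dots> = ennreal (L2_norm_sq M f * L2_norm_sq M g)"
    by (simp add: nn f g ennreal_mult L2_norm_sq_def)
  finally have "?I\<^sup>2 \<le> L2_norm_sq M f * L2_norm_sq M g"
    by (simp add: ennreal_power L2_norm_sq_def)
  then have "?I \<le> sqrt (L2_norm_sq M f) * sqrt (L2_norm_sq M g)"
    by (simp add: real_le_rsqrt flip: real_sqrt_mult)
  moreover have "cmod (L2_inner M f g) \<le> ?I"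
    unfolding L2_inner_def using integral_norm_bound[of M "\<lambda>x. cnj (f x) * g x"]
    by (simp add: norm_mult)
  ultimately show ?thesis by simp
qed

lemma square_integrable_mult_bounded:
  fixes l :: "'g \<Rightarrow> real"
  assumes f: "square_integrable M f" and l: "l \<in> borel_measurable M" "\<And>x. \<bar>l x\<bar> \<le> 1"
  shows "square_integrable M (\<lambda>x. complex_of_real (l x) * f x)"
proof -
  have [measurable]: "f \<in> borel_measurable M" "l \<in> borel_measurable M"
    and int: "integrable M (\<lambda>x. (cmod (f x))\<^sup>2)"
    using f l by (simp_all add: square_integrable_def)
  have "(cmod (complex_of_real (l x) * f x))\<^sup>2 \<le> (cmod (f x))\<^sup>2" for x
    using mult_right_mono[OF l(2)[of x] norm_ge_zero[of "f x"]]
    by (intro power_mono) (auto simp: norm_mult)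
  then have "integrable M (\<lambda>x. (cmod (complex_of_real (l x) * f x))\<^sup>2)"
    by (intro Bochner_Integration.integrable_bound[OF int]) auto
  then show ?thesis by (simp add: square_integrable_def)
qed

lemma bounded_vectorsE:
  assumes "\<eta> \<in> bounded_vectors M U"
  obtains k where "k \<ge> 0" "\<And>\<theta>. square_integrable M (coeff U \<eta> \<theta>)"
    "\<And>\<theta>. sqrt (L2_norm_sq M (coeff U \<eta> \<theta>)) \<le> k * norm \<theta>"
proof -
  obtain k where k: "\<And>\<theta>. square_integrable M (coeff U \<eta> \<theta>)"
    "\<And>\<theta>. sqrt (L2_norm_sq M (coeff U \<eta> \<theta>)) \<le> k * norm \<theta>"
    using assms unfolding bounded_vectors_def U_bounded_def by blast
  show thesis
  proof (rule that[of "\<bar>k\<bar>"])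
    show "sqrt (L2_norm_sq M (coeff U \<eta> \<theta>)) \<le> \<bar>k\<bar> * norm \<theta>" for \<theta>
      by (rule order_trans[OF k(2)]) (intro mult_right_mono, auto)
  qed (use k(1) in auto)
qed

lemma bounded_vectors_square_integrable:
  "\<eta> \<in> bounded_vectors M U \<Longrightarrow> square_integrable M (coeff U \<eta> \<theta>)"
  unfolding bounded_vectors_def U_bounded_def by blast

lemma coeff_simps:
  "coeff U \<eta> (v + w) x = coeff U \<eta> v x + coeff U \<eta> w x"
  "coeff U \<eta> (a *\<^sub>C v) x = a * coeff U \<eta> v x"
  by (simp_all add: coeff_def cinner_bilinear_simps)

lemma L2_inner_coeff_simps:
  assumes "\<And>\<theta>. square_integrable M (coeff U \<eta> \<theta>)" "square_integrable M g"
  shows "L2_inner M (coeff U \<eta> (v + w)) g = L2_inner M (coeff U \<eta> v) g + L2_inner M (coeff U \<eta> w) g"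
    "L2_inner M (coeff U \<eta> (a *\<^sub>C v)) g = cnj a * L2_inner M (coeff U \<eta> v) g"
    "L2_inner M g (coeff U \<eta> (v + w)) = L2_inner M g (coeff U \<eta> v) + L2_inner M g (coeff U \<eta> w)"
    "L2_inner M g (coeff U \<eta> (a *\<^sub>C v)) = a * L2_inner M g (coeff U \<eta> v)"
proof -
  note int = square_integrable_integrable_inner[OF assms(1) assms(2)]
    square_integrable_integrable_inner[OF assms(2) assms(1)]
  show "L2_inner M (coeff U \<eta> (v + w)) g = L2_inner M (coeff U \<eta> v) g + L2_inner M (coeff U \<eta> w) g"
    "L2_inner M g (coeff U \<eta> (v + w)) = L2_inner M g (coeff U \<eta> v) + L2_inner M g (coeff U \<eta> w)"
    using int by (simp_all add: L2_inner_def coeff_simps distrib_left distrib_right)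
  show "L2_inner M (coeff U \<eta> (a *\<^sub>C v)) g = cnj a * L2_inner M (coeff U \<eta> v) g"
    "L2_inner M g (coeff U \<eta> (a *\<^sub>C v)) = a * L2_inner M g (coeff U \<eta> v)"
    by (simp_all add: L2_inner_def coeff_simps mult.assoc mult.left_commute)
qed

text \<open>The vector \<open>v\<close> is \<open>T\<^sub>\<eta> g\<close>.\<close>

lemma coeff_adjoint_exists:
  assumes \<eta>: "\<eta> \<in> bounded_vectors M U" and g: "square_integrable M g"
  shows "\<exists>v. \<forall>\<theta>. cinner \<theta> v = L2_inner M (coeff U \<eta> \<theta>) g"
proof -
  obtain k where k: "\<And>\<theta>. square_integrable M (coeff U \<eta> \<theta>)"
    "\<And>\<theta>. sqrt (L2_norm_sq M (coeff U \<eta> \<theta>)) \<le> k * norm \<theta>"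
    by (rule bounded_vectorsE[OF \<eta>]) blast
  \<comment> \<open>The pairing is antilinear in \<theta>; Riesz representation needs its
    conjugate.\<close>
  have "\<exists>v. \<forall>\<theta>. cnj (L2_inner M (coeff U \<eta> \<theta>) g) = cinner v \<theta>"
  proof (rule Riesz_representation)
    show "cmod (cnj (L2_inner M (coeff U \<eta> \<theta>) g)) \<le> (k * sqrt (L2_norm_sq M g)) * norm \<theta>" for \<theta>
    proof -
      have "cmod (L2_inner M (coeff U \<eta> \<theta>) g) \<le> sqrt (L2_norm_sq M (coeff U \<eta> \<theta>)) * sqrt (L2_norm_sq M g)"
        by (rule L2_inner_Cauchy_Schwarz[OF k(1) g])
      also have "\<dots> \<le> (k * norm \<theta>) * sqrt (L2_norm_sq M g)"
        by (rule mult_right_mono[OF k(2)]) (simp add: L2_norm_sq_def)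
      finally show ?thesis by (simp add: ac_simps)
    qed
  qed (simp_all add: L2_inner_coeff_simps k g)
  then show ?thesis by (metis cinner_commute complex_cnj_cnj)
qed

text \<open>Inversion exchanges the two vectors of a coefficient. Boundedness of \<eta> controls
  \<open>coeff U \<eta> \<xi>\<close>, and through this identity also
  \<open>coeff U \<xi> \<eta>\<close>.\<close>

lemma coeff_unitary_swap:
  assumes "unitary_rep U"
  shows "coeff U \<eta> \<theta> (- x) = cnj (coeff U \<theta> \<eta> x)"
  unfolding coeff_def by (subst unitary_rep_adjoint[OF assms]) (simp add: cinner_commute[of \<eta>])

lemma continuous_on_coeff:
  assumes "unitary_rep U"
  shows "continuous_on UNIV (coeff U \<eta> \<theta>)"
proof -
  have "bounded_linear (\<lambda>v. cinner v \<theta>)"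
    by (rule bounded_linear_intro[where K = "norm \<theta>"])
       (auto simp: cinner_bilinear_simps scaleR_conv_of_real cinner_Cauchy_Schwarz)
  moreover have "continuous_on UNIV (\<lambda>x. U x \<eta>)"
    using assms by (simp add: unitary_rep_def)
  ultimately show ?thesis
    unfolding coeff_def by (rule bounded_linear.continuous_on)
qed

context haar_group
begin

text \<open>Inner regularity at the threshold \<open>?I - e\<close> makes the cutoffs converge in L2
  without sigma-finiteness.\<close>

lemma compact_tail_integral:
  fixes P :: "'g \<Rightarrow> real"
  assumes P: "continuous_on UNIV P" and pos: "\<And>x. 0 \<le> P x" and int: "integrable M P"
    and e: "e > 0"
  obtains K where "compact K" "(\<integral>x. P x * indicator (- K) x \<partial>M) < e"
\<comment> \<open>If the total is below \<open>e\<close>, the empty set works; the split is needed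
  because \<open>ennreal\<close> sends the then negative threshold to 0.\<close>
proof (cases "(\<integral>x. P x \<partial>M) < e")
  case True
  then show ?thesis using that[of "{}"] by simp
next
  case False
  let ?I = "\<integral>x. P x \<partial>M"
  have "ennreal (?I - e) < (\<integral>\<^sup>+x. P x \<partial>M)"
    using False e pos nn_integral_eq_integral[OF int] by (simp add: ennreal_lessI)
  from nn_integral_inner_regular[OF P pos this]
  obtain K where K: "compact K" "ennreal (?I - e) < (\<integral>\<^sup>+x. P x * indicator K x \<partial>M)"
    by blast
  have iK: "integrable M (\<lambda>x. P x * indicator K x)"
    using compact_sets[OF K(1)] int by (rule integrable_real_mult_indicator)
  have "ennreal (?I - e) < ennreal (\<integral>x. P x * indicator K x \<partial>M)"
    using K(2) nn_integral_eq_integral[OF iK] pos by simp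
  then have "?I - e < (\<integral>x. P x * indicator K x \<partial>M)"
    using False by (simp add: ennreal_less_iff)
  moreover have "(\<integral>x. P x * indicator (- K) x \<partial>M) = (\<integral>x. P x - P x * indicator K x \<partial>M)"
    by (rule Bochner_Integration.integral_cong) (auto simp: indicator_def)
  ultimately show ?thesis using that[OF K(1)] int iK by simp
qed

text \<open>Replacing \<theta> by \<open>U y \<theta>\<close> translates the coefficient by
  \<open>- y\<close> on the left, so left invariance of Haar measure is exactly invariance of this
  form.\<close>

lemma coeff_inner_scalar:
  assumes rep: "unitary_rep U" and irred: "irreducible_rep U"
    and \<eta>: "\<eta> \<in> bounded_vectors M U" and \<zeta>: "\<zeta> \<in> bounded_vectors M U"
  shows "\<exists>c. \<forall>\<theta> \<omega>. L2_inner M (coeff U \<eta> \<theta>) (coeff U \<zeta> \<omega>) = c * cinner \<theta> \<omega>"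
proof (rule invariant_form_scalar[OF rep irred])
  obtain k where k: "k \<ge> 0" "\<And>\<theta>. square_integrable M (coeff U \<eta> \<theta>)"
    "\<And>\<theta>. sqrt (L2_norm_sq M (coeff U \<eta> \<theta>)) \<le> k * norm \<theta>"
    by (rule bounded_vectorsE[OF \<eta>]) blast
  obtain j where j: "j \<ge> 0" "\<And>\<theta>. square_integrable M (coeff U \<zeta> \<theta>)"
    "\<And>\<theta>. sqrt (L2_norm_sq M (coeff U \<zeta> \<theta>)) \<le> j * norm \<theta>"
    by (rule bounded_vectorsE[OF \<zeta>]) blast
  have "cmod (L2_inner M (coeff U \<eta> \<theta>) (coeff U \<zeta> \<omega>)) \<le> (k * j) * norm \<theta> * norm \<omega>" for \<theta> \<omega>
  proof -
    have "cmod (L2_inner M (coeff U \<eta> \<theta>) (coeff U \<zeta> \<omega>))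
        \<le> sqrt (L2_norm_sq M (coeff U \<eta> \<theta>)) * sqrt (L2_norm_sq M (coeff U \<zeta> \<omega>))"
      by (rule L2_inner_Cauchy_Schwarz[OF k(2) j(2)])
    also have "\<dots> \<le> (k * norm \<theta>) * (j * norm \<omega>)"
      by (rule mult_mono[OF k(3) j(3)]) (use k(1) in \<open>auto simp: L2_norm_sq_def\<close>)
    finally show ?thesis by (simp add: mult.assoc mult.left_commute)
  qed
  then show "bounded_sesquilinear (\<lambda>\<theta> \<omega>. L2_inner M (coeff U \<eta> \<theta>) (coeff U \<zeta> \<omega>))"
    unfolding bounded_sesquilinear_def
    by (intro conjI allI exI[of _ "k * j"]) (simp_all add: L2_inner_coeff_simps k(2) j(2))
  fix y \<theta> \<omega>
  have shift: "coeff U \<alpha> (U y \<beta>) x = coeff U \<alpha> \<beta> (- y + x)" for \<alpha> \<beta> x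
  proof -
    have "cinner (U (- y + x) \<alpha>) \<beta> = cinner (U y (U (- y + x) \<alpha>)) (U y \<beta>)"
      by (simp only: unitary_rep_simps(3)[OF rep])
    also have "U y (U (- y + x) \<alpha>) = U (y + (- y + x)) \<alpha>"
      by (simp only: unitary_rep_simps(4)[OF rep])
    finally show ?thesis by (simp add: coeff_def flip: add.assoc)
  qed
  have "(\<lambda>x. cnj (coeff U \<eta> \<theta> x) * coeff U \<zeta> \<omega> x) \<in> borel_measurable M"
    using square_integrable_integrable_inner[OF k(2) j(2)] by (rule borel_measurable_integrable)
  from integral_left_translation[OF this, of "- y"]
  show "L2_inner M (coeff U \<eta> (U y \<theta>)) (coeff U \<zeta> (U y \<omega>)) = L2_inner M (coeff U \<eta> \<theta>) (coeff U \<zeta> \<omega>)"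
    by (simp add: L2_inner_def shift)
qed

lemma modular_powr_square: "(\<Delta> x powr (-1/2))\<^sup>2 = \<Delta> (- x)"
proof -
  have "(\<Delta> x powr (-1/2))\<^sup>2 = \<Delta> x powr (- 1)"
    unfolding power2_eq_square powr_add[symmetric] by simp
  then show ?thesis using modular_pos[of x] by (simp add: modular_inverse powr_minus)
qed

text \<open>The squared weight is \<open>\<Delta> (- x)\<close>, just the factor of the inversion
  formula, so the weighted L2 norm of \<open>coeff U \<xi> \<eta>\<close> is the unweighted one of
  \<open>coeff U \<eta> \<xi>\<close>.\<close>

lemma square_integrable_modular_coeff:
  assumes rep: "unitary_rep U" and \<eta>: "\<eta> \<in> bounded_vectors M U"
  shows "square_integrable M (\<lambda>x. complex_of_real (\<Delta> x powr (-1/2)) * coeff U \<xi> \<eta> x)"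
  unfolding square_integrable_def
proof
  have cont: "continuous_on UNIV (\<lambda>x. \<Delta> x powr (-1/2))"
    using modular_pos less_imp_neq[OF modular_pos] by (intro continuous_on_powr continuous_on_modular continuous_intros) auto
  then show "(\<lambda>x. complex_of_real (\<Delta> x powr (-1/2)) * coeff U \<xi> \<eta> x) \<in> borel_measurable M"
    by (intro borel_measurable_continuous continuous_on_mult continuous_on_of_real
        continuous_on_coeff[OF rep])
  have "square_integrable M (coeff U \<eta> \<xi>)" using \<eta> by (rule bounded_vectors_square_integrable)
  then have "integrable M (\<lambda>x. (cmod (coeff U \<xi> \<eta> (- x)))\<^sup>2)"
    by (simp add: coeff_unitary_swap[OF rep] square_integrable_def)
  moreover have "continuous_on UNIV (\<lambda>x. (cmod (coeff U \<xi> \<eta> x))\<^sup>2)"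
    by (intro continuous_intros continuous_on_coeff[OF rep])
  ultimately have "integrable M (\<lambda>x. (cmod (coeff U \<xi> \<eta> x))\<^sup>2 * \<Delta> (- x))"
    using has_bochner_integral_inversion_real integrable.intros by blast
  then show "integrable M (\<lambda>x. (cmod (complex_of_real (\<Delta> x powr (-1/2)) * coeff U \<xi> \<eta> x))\<^sup>2)"
    by (simp add: norm_mult power_mult_distrib modular_powr_square[simplified] mult.commute)
qed

text \<open>Inversion conjugates both coefficients, so the conjugated factor passes from \<zeta> to
  \<eta>; this explains the reversed order on the two sides.\<close>

lemma L2_inner_modular_coeff:
  assumes rep: "unitary_rep U" and \<eta>: "\<eta> \<in> bounded_vectors M U" and \<zeta>: "\<zeta> \<in> bounded_vectors M U"
  shows "L2_inner M (\<lambda>x. complex_of_real (\<Delta> x powr (-1/2)) * coeff U \<xi> \<zeta> x)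
      (\<lambda>x. complex_of_real (\<Delta> x powr (-1/2)) * coeff U \<xi> \<eta> x)
    = L2_inner M (coeff U \<eta> \<xi>) (coeff U \<zeta> \<xi>)"
proof -
  have "square_integrable M (coeff U \<eta> \<xi>)" "square_integrable M (coeff U \<zeta> \<xi>)"
    using \<eta> \<zeta> by (simp_all add: bounded_vectors_square_integrable)
  note int = square_integrable_integrable_inner[OF this]
  define F where "F x = cnj (coeff U \<xi> \<zeta> x) * coeff U \<xi> \<eta> x" for x
  have F: "F (- x) = cnj (coeff U \<eta> \<xi> x) * coeff U \<zeta> \<xi> x" for x
    by (simp add: F_def coeff_unitary_swap[OF rep])
  have "continuous_on UNIV F"
    unfolding F_def by (intro continuous_on_mult continuous_on_cnj continuous_on_coeff[OF rep])
  then have "has_bochner_integral M (\<lambda>x. F x * complex_of_real (\<Delta> (- x))) (\<integral>x. F (- x) \<partial>M)"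
    using int by (intro has_bochner_integral_inversion) (simp_all add: F)
  then have "(\<integral>x. F x * complex_of_real (\<Delta> (- x)) \<partial>M) = L2_inner M (coeff U \<eta> \<xi>) (coeff U \<zeta> \<xi>)"
    by (simp add: has_bochner_integral_integral_eq F L2_inner_def)
  moreover have "cnj (complex_of_real (\<Delta> x powr (-1/2)) * coeff U \<xi> \<zeta> x) *
      (complex_of_real (\<Delta> x powr (-1/2)) * coeff U \<xi> \<eta> x) = F x * complex_of_real (\<Delta> (- x))" for x
    unfolding modular_powr_square[symmetric] F_def by (simp add: power2_eq_square)
  ultimately show ?thesis by (simp add: L2_inner_def)
qed

section \<open>The operator integral\<close>

text \<open>Paired with \<theta>, the integrand is a product of two L2 functions, so integrability
  is automatic and only the value remains: \<open>v\<close> is T_\<eta> applied to the cut-off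
  coefficient of \<zeta>.\<close>

lemma has_weak_integral_alpha_rank_one:
  assumes rep: "unitary_rep U" and \<eta>: "\<eta> \<in> bounded_vectors M U" and \<zeta>: "\<zeta> \<in> bounded_vectors M U"
    and l: "l \<in> cutoffs M"
  shows "has_weak_integral M (\<lambda>x. l x *\<^sub>R alpha U x (rank_one \<eta> \<zeta>) \<omega>) v \<longleftrightarrow>
    (\<forall>\<theta>. cinner \<theta> v = L2_inner M (coeff U \<eta> \<theta>) (\<lambda>x. complex_of_real (l x) * coeff U \<zeta> \<omega> x))"
proof -
  have eq: "cinner \<theta> (l x *\<^sub>R alpha U x (rank_one \<eta> \<zeta>) \<omega>)
      = cnj (coeff U \<eta> \<theta> x) * (complex_of_real (l x) * coeff U \<zeta> \<omega> x)" for \<theta> x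
    unfolding alpha_def rank_one_def coeff_def
    by (simp add: unitary_rep_simps(2)[OF rep] cinner_bilinear_simps cinner_commute[of \<theta>]
        flip: unitary_rep_adjoint[OF rep])
  have "square_integrable M (coeff U \<zeta> \<omega>)" using \<zeta> by (rule bounded_vectors_square_integrable)
  then have g: "square_integrable M (\<lambda>x. complex_of_real (l x) * coeff U \<zeta> \<omega> x)"
    using l by (intro square_integrable_mult_bounded) (auto simp: cutoffs_def)
  have "square_integrable M (coeff U \<eta> \<theta>)" for \<theta> using \<eta> by (rule bounded_vectors_square_integrable)
  then have "integrable M (\<lambda>x. cnj (coeff U \<eta> \<theta> x) * (complex_of_real (l x) * coeff U \<zeta> \<omega> x))" for \<theta>
    using square_integrable_integrable_inner[OF _ g] by blast
  then show ?thesis unfolding has_weak_integral_def eq L2_inner_def by simp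
qed

text \<open>T_\<eta> is bounded, so it is enough that the cut-off coefficients
  \<open>l x * coeff U \<zeta> \<omega> x\<close> converge in L2.\<close>

lemma sot_integral_alpha_rank_one:
  assumes rep: "unitary_rep U" and \<eta>: "\<eta> \<in> bounded_vectors M U" and \<zeta>: "\<zeta> \<in> bounded_vectors M U"
    and T: "\<And>\<theta> \<omega>. cinner \<theta> (T \<omega>) = L2_inner M (coeff U \<eta> \<theta>) (coeff U \<zeta> \<omega>)"
  shows "sot_integral M (\<lambda>x. alpha U x (rank_one \<eta> \<zeta>)) T"
  unfolding sot_integral_def
proof (intro conjI ballI allI impI)
  have sq: "square_integrable M (coeff U \<zeta> \<omega>)" for \<omega> using \<zeta> by (rule bounded_vectors_square_integrable)
  obtain k where k: "k \<ge> 0" "\<And>\<theta>. square_integrable M (coeff U \<eta> \<theta>)"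
    "\<And>\<theta>. sqrt (L2_norm_sq M (coeff U \<eta> \<theta>)) \<le> k * norm \<theta>"
    by (rule bounded_vectorsE[OF \<eta>]) blast
  show "\<exists>v. has_weak_integral M (\<lambda>x. l x *\<^sub>R alpha U x (rank_one \<eta> \<zeta>) \<omega>) v"
    if l: "l \<in> cutoffs M" for l \<omega>
    unfolding has_weak_integral_alpha_rank_one[OF rep \<eta> \<zeta> l]
    using l by (intro coeff_adjoint_exists[OF \<eta>] square_integrable_mult_bounded[OF sq])
      (auto simp: cutoffs_def)
  fix \<omega> and \<epsilon> :: real assume \<epsilon>: "\<epsilon> > 0"
  \<comment> \<open>The final estimate is \<open>k * e\<close>; the summand 1 allows
    \<open>k = 0\<close>.\<close>
  define e where "e = \<epsilon> / (k + 1)"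
  have e: "e > 0" "k * e < \<epsilon>" using \<epsilon> k(1) by (auto simp: e_def pos_divide_less_eq)
  define P where "P x = (cmod (coeff U \<zeta> \<omega> x))\<^sup>2" for x
  have P: "continuous_on UNIV P"
    unfolding P_def by (intro continuous_intros continuous_on_coeff[OF rep])
  have P_int: "integrable M P" using sq unfolding P_def square_integrable_def by blast
  obtain K where K: "compact K" "(\<integral>x. P x * indicator (- K) x \<partial>M) < e\<^sup>2"
    using compact_tail_integral[OF P _ P_int, of "e\<^sup>2"] e(1) by (auto simp: P_def)
  have PK_int: "integrable M (\<lambda>x. P x * indicator (- K) x)"
    using compact_sets[OF K(1)] P_int
    by (intro integrable_real_mult_indicator) (auto simp: sets_M)
  show "\<exists>l0\<in>cutoffs M. \<forall>l\<in>cutoffs M. (AE x in M. l0 x \<le> l x) \<longrightarrow>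
      (\<forall>v. has_weak_integral M (\<lambda>x. l x *\<^sub>R alpha U x (rank_one \<eta> \<zeta>) \<omega>) v \<longrightarrow> norm (v - T \<omega>) < \<epsilon>)"
  proof (intro bexI[of _ "indicator K"] ballI impI allI)
    show "indicator K \<in> cutoffs M"
      using K(1) compact_sets[OF K(1)] unfolding cutoffs_def by (auto simp: indicator_def)
    fix l v
    assume l: "l \<in> cutoffs M" and le: "AE x in M. indicator K x \<le> l x"
      and "has_weak_integral M (\<lambda>x. l x *\<^sub>R alpha U x (rank_one \<eta> \<zeta>) \<omega>) v"
    then have v: "cinner \<theta> v = L2_inner M (coeff U \<eta> \<theta>) (\<lambda>x. complex_of_real (l x) * coeff U \<zeta> \<omega> x)" for \<theta>
      by (simp add: has_weak_integral_alpha_rank_one[OF rep \<eta> \<zeta> l])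
    have l01: "0 \<le> l x" "l x \<le> 1" and lm: "l \<in> borel_measurable M" for x
      using l by (auto simp: cutoffs_def)
    have abs_l: "\<bar>l x - 1\<bar> \<le> 1" "\<bar>l x\<bar> \<le> 1" for x using l01[of x] by auto
    \<comment> \<open>A cutoff above the indicator of \<open>K\<close> equals 1 almost everywhere on
      \<open>K\<close>, so the error \<open>h\<close> lives on the small tail.\<close>
    define h where "h x = complex_of_real (l x - 1) * coeff U \<zeta> \<omega> x" for x
    have h: "square_integrable M h"
      unfolding h_def using lm abs_l by (intro square_integrable_mult_bounded[OF sq]) auto
    have "L2_norm_sq M h \<le> (\<integral>x. P x * indicator (- K) x \<partial>M)"
      unfolding L2_norm_sq_def
    proof (rule integral_mono_AE)
      show "integrable M (\<lambda>x. (cmod (h x))\<^sup>2)" using h by (simp add: square_integrable_def)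
      show "AE x in M. (cmod (h x))\<^sup>2 \<le> P x * indicator (- K) x"
        using le
      proof eventually_elim
        case (elim x)
        show ?case
        proof (cases "x \<in> K")
          case True
          then have "l x = 1" using elim l01[of x] by simp
          then show ?thesis using True by (simp add: h_def)
        next
          case False
          have "cmod (h x) \<le> 1 * cmod (coeff U \<zeta> \<omega> x)"
            unfolding h_def norm_mult norm_of_real by (intro mult_right_mono abs_l norm_ge_zero)
          then show ?thesis using False by (simp add: P_def power_mono)
        qed
      qed
    qed (rule PK_int)
    then have "L2_norm_sq M h \<le> e\<^sup>2" using K(2) by simp
    then have sqrt_h: "sqrt (L2_norm_sq M h) \<le> e"
      using e(1) by (intro real_le_lsqrt) (auto simp: L2_norm_sq_def)
    let ?d = "v - T \<omega>"
    \<comment> \<open>Testing the difference against itself gives its squared norm; Cauchy-Schwarz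
      leaves one factor \<open>norm ?d\<close> to cancel.\<close>
    have "cinner ?d ?d = L2_inner M (coeff U \<eta> ?d) h"
    proof -
      have "cinner ?d ?d = (\<integral>x. cnj (coeff U \<eta> ?d x) * (complex_of_real (l x) * coeff U \<zeta> \<omega> x) \<partial>M)
          - (\<integral>x. cnj (coeff U \<eta> ?d x) * coeff U \<zeta> \<omega> x \<partial>M)"
        unfolding cinner_diff_right v T L2_inner_def ..
      also have "\<dots> = (\<integral>x. cnj (coeff U \<eta> ?d x) * (complex_of_real (l x) * coeff U \<zeta> \<omega> x)
          - cnj (coeff U \<eta> ?d x) * coeff U \<zeta> \<omega> x \<partial>M)"
        using lm abs_l
        by (intro Bochner_Integration.integral_diff[symmetric] square_integrable_integrable_inner
            square_integrable_mult_bounded k sq) auto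
      finally show ?thesis by (simp add: L2_inner_def h_def algebra_simps)
    qed
    then have "norm ?d * norm ?d = cmod (L2_inner M (coeff U \<eta> ?d) h)"
      by (metis cinner_self_norm norm_of_real abs_power2 power2_eq_square)
    also have "\<dots> \<le> sqrt (L2_norm_sq M (coeff U \<eta> ?d)) * sqrt (L2_norm_sq M h)"
      by (rule L2_inner_Cauchy_Schwarz[OF k(2) h])
    also have "\<dots> \<le> (k * norm ?d) * e"
      by (rule mult_mono[OF k(3) sqrt_h]) (use k(1) in \<open>auto simp: L2_norm_sq_def\<close>)
    finally have "norm ?d * norm ?d \<le> (k * e) * norm ?d" by (simp add: mult.commute mult.left_commute)
    then have "norm ?d \<le> k * e \<or> norm ?d = 0" by (auto simp: mult_le_cancel_right)
    then show "norm ?d < \<epsilon>" using e(2) \<epsilon> by auto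
  qed
qed

end

theorem theorem8p8:
  fixes M :: "'g::{group_add, t2_space} measure"
    and \<Delta> :: "'g \<Rightarrow> real"
    and U :: "'g \<Rightarrow> 'h::complex_hilbert \<Rightarrow> 'h"
    and \<xi> \<eta> \<zeta> :: 'h
  assumes G: "locally_compact_group TYPE('g)"
    and haar: "left_haar_measure M"
    and modular: "modular_function M \<Delta>"
    and rep: "unitary_rep U"
    and irred: "irreducible_rep U"
    and sqint: "square_integrable_rep M U"
    and xi: "\<xi> \<in> bounded_vectors M U"
    and isom: "\<forall>\<omega>. L2_norm_sq M (coeff U \<xi> \<omega>) = (norm \<omega>)\<^sup>2"
    and eta: "\<eta> \<in> bounded_vectors M U"
    and zeta: "\<zeta> \<in> bounded_vectors M U"
  shows "square_integrable M (\<lambda>x. complex_of_real (\<Delta> x powr (-1/2)) * coeff U \<xi> \<eta> x)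
    \<and> square_integrable M (\<lambda>x. complex_of_real (\<Delta> x powr (-1/2)) * coeff U \<xi> \<zeta> x)
    \<and> sot_integral M (\<lambda>x. alpha U x (rank_one \<eta> \<zeta>))
        (\<lambda>\<omega>. (inverse (complex_of_real ((norm \<xi>)\<^sup>2)) *
               L2_inner M (\<lambda>x. complex_of_real (\<Delta> x powr (-1/2)) * coeff U \<xi> \<zeta> x)
                          (\<lambda>x. complex_of_real (\<Delta> x powr (-1/2)) * coeff U \<xi> \<eta> x)) *\<^sub>C \<omega>)"
proof -
  interpret haar_group M \<Delta> by unfold_locales fact+
  \<comment> \<open>For \<xi> = 0 all its coefficients vanish, and the isometry condition would make
    the whole space zero, against irreducibility.\<close>
  have "\<xi> \<noteq> 0"
  proof
    assume "\<xi> = 0"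
    moreover have "U x 0 = 0" for x using unitary_rep_diff[OF rep, of x 0 0] by simp
    ultimately have "norm \<omega> = 0" for \<omega> :: 'h
      using isom[rule_format, of \<omega>] by (simp add: coeff_def L2_norm_sq_def)
    then show False using irred by (auto simp: irreducible_rep_def)
  qed
  obtain c where c: "\<And>\<theta> \<omega>. L2_inner M (coeff U \<eta> \<theta>) (coeff U \<zeta> \<omega>) = c * cinner \<theta> \<omega>"
    using coeff_inner_scalar[OF rep irred eta zeta] by blast
  have "inverse (complex_of_real ((norm \<xi>)\<^sup>2)) *
      L2_inner M (\<lambda>x. complex_of_real (\<Delta> x powr (-1/2)) * coeff U \<xi> \<zeta> x)
        (\<lambda>x. complex_of_real (\<Delta> x powr (-1/2)) * coeff U \<xi> \<eta> x) = c"
    unfolding L2_inner_modular_coeff[OF rep eta zeta] c cinner_self_norm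
    using \<open>\<xi> \<noteq> 0\<close> by simp
  moreover have "sot_integral M (\<lambda>x. alpha U x (rank_one \<eta> \<zeta>)) (\<lambda>\<omega>. c *\<^sub>C \<omega>)"
    by (rule sot_integral_alpha_rank_one[OF rep eta zeta]) (simp add: c cinner_scaleC_right)
  ultimately show ?thesis
    using square_integrable_modular_coeff[OF rep] eta zeta by simp
qed

end
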